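(* Let $T=\{3412,3421,2143\}$ and let $F_T(x)=\sum_{n\ge0}|S_n(T)|x^n$. Then $$F_T(x)=\frac{1-8x+23x^2-27x^3+12x^4-5x^5}{(1-3x+x^2)^3}.$$
   Context: $S_n$ is the set of permutations of $[n]$ ($S_0$ contains the empty permutation). A permutation avoids a pattern $\tau$ if it has no subsequence order-isomorphic to $\tau$; $S_n(T)$ is the set of permutations in $S_n$ avoiding every pattern in $T$. *)

theory Defs
  imports
    "HOL-Combinatorics.Multiset_Permutations"
    "HOL-Library.Sublist"
    "HOL-Computational_Algebra.Formal_Power_Series"
begin

text \<open>
  Permutations of \<open>[n]\<close> are written in one-line notation: the list
  \<open>[\<pi>(1), \<dots>, \<pi>(n)]\<close>, an element of \<^term>\<open>permutations_of_set {1..n}\<close>.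
\<close>

definition order_isomorphic :: "nat list \<Rightarrow> nat list \<Rightarrow> bool" where
  "order_isomorphic xs ys \<longleftrightarrow> length xs = length ys \<and>
     (\<forall>i<length xs. \<forall>j<length xs. xs ! i < xs ! j \<longleftrightarrow> ys ! i < ys ! j)"

text \<open>\<^const>\<open>subseq\<close> is the library's relation of not necessarily contiguous subsequences.\<close>

definition avoids :: "nat list \<Rightarrow> nat list \<Rightarrow> bool" where
  "avoids p \<tau> \<longleftrightarrow> \<not> (\<exists>s. subseq s p \<and> order_isomorphic s \<tau>)"

definition avoiders :: "nat \<Rightarrow> nat list set \<Rightarrow> nat list set" where
  "avoiders n T = {p \<in> permutations_of_set {1..n}. \<forall>\<tau>\<in>T. avoids p \<tau>}"

definition avoiders_gf :: "nat list set \<Rightarrow> rat fps" where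
  "avoiders_gf T = Abs_fps (\<lambda>n. of_nat (card (avoiders n T)))"

end

theory Submission
  imports Defs
begin

text \<open>
  Decompose an avoider by its first entry \<open>a\<close>, with \<open>B = [a+1, \<dots>, n]\<close>.
  If \<open>a = 1\<close>, the rest is an arbitrary avoider. If \<open>a = 2\<close>, deleting the
  entries 2 and 1 leaves a permutation avoiding 231 and 2143, and the entries to the right of 1 are
  increasing. If \<open>a \<ge> 3\<close>, the entries above \<open>a\<close> are increasing, and since 3412 and
  3421 are avoided, at most one entry below \<open>a\<close> follows any of them: the rest is obtained
  from an avoider \<open>p\<close> of size \<open>a - 1\<close> by inserting an initial segment of \<open>B\<close>
  before the last entry of \<open>p\<close> and the remainder of \<open>B\<close> after it. A nonempty initial
  segment is possible exactly when the entries of \<open>p\<close> smaller than its last entry are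
  increasing. The same decomposition counts the auxiliary classes, so all four counting sequences
  satisfy linear recurrences with characteristic factor \<open>1 - 3x + x\<^sup>2\<close>.
\<close>

section \<open>Short subsequences and forbidden patterns\<close>

declare subseq_Cons2_iff [simp del]

text \<open>When \<open>x = y\<close> the alternatives may overlap: a match inside \<open>ys\<close>
  also yields a match of the tail. The disjunction needs no decision whether \<open>x = y\<close>,
  which suits the splits into blocks below.\<close>

lemma subseq_Cons_right:
  "subseq [] (y # ys)"
  "subseq (x # xs) (y # ys) \<longleftrightarrow> x = y \<and> subseq xs ys \<or> subseq (x # xs) ys"
  by (auto simp: subseq_Cons2_iff dest: subseq_Cons')

lemma subseq2_append:
  "subseq [a, b] (xs @ ys) \<longleftrightarrow>
     subseq [a, b] xs \<or> a \<in> set xs \<and> b \<in> set ys \<or> subseq [a, b] ys"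
  by (induction xs) (auto simp: subseq_Cons_right subseq_singleton_left)

lemma subseq3_append:
  "subseq [a, b, c] (xs @ ys) \<longleftrightarrow>
     subseq [a, b, c] xs \<or> subseq [a, b] xs \<and> c \<in> set ys \<or>
     a \<in> set xs \<and> subseq [b, c] ys \<or> subseq [a, b, c] ys"
  by (induction xs) (auto simp: subseq_Cons_right subseq_singleton_left subseq2_append)

lemma subseq4_append:
  "subseq [a, b, c, d] (xs @ ys) \<longleftrightarrow>
     subseq [a, b, c, d] xs \<or> subseq [a, b, c] xs \<and> d \<in> set ys \<or>
     subseq [a, b] xs \<and> subseq [c, d] ys \<or>
     a \<in> set xs \<and> subseq [b, c, d] ys \<or> subseq [a, b, c, d] ys"
  by (induction xs) (auto simp: subseq_Cons_right subseq_singleton_left subseq2_append subseq3_append)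

lemmas subseq_simps = subseq_Cons_right subseq_singleton_left
  subseq2_append subseq3_append subseq4_append

lemma subseq2_set: "subseq [a, b] xs \<Longrightarrow> a \<in> set xs \<and> b \<in> set xs"
  by (induction xs) (auto simp: subseq_simps)

lemma subseq2_distinct: "subseq [a, b] xs \<Longrightarrow> distinct xs \<Longrightarrow> a \<noteq> b"
  by (induction xs) (auto simp: subseq_simps)

text \<open>Lets sortedness of a block be compared with avoidance of a pattern: violations of both
  become short subsequences.\<close>

lemma sorted_iff_subseq:
  "sorted (xs :: nat list) \<longleftrightarrow> (\<forall>a b. subseq [a, b] xs \<longrightarrow> a \<le> b)"
proof (induction xs)
  case (Cons x xs)
  have "sorted (x # xs) \<longleftrightarrow> (\<forall>y\<in>set xs. x \<le> y) \<and> sorted xs"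
    by simp
  also have "\<dots> \<longleftrightarrow> (\<forall>a b. subseq [a, b] (x # xs) \<longrightarrow> a \<le> b)"
    unfolding Cons.IH subseq_Cons_right subseq_singleton_left by blast
  finally show ?case .
qed simp

lemma subseq3_pairs:
  "subseq [a, b, c] xs \<Longrightarrow> subseq [a, b] xs \<and> subseq [b, c] xs \<and> subseq [a, c] xs"
  by (induction xs) (auto simp: subseq_simps dest: subseq2_set)

lemma subseq4_triples:
  "subseq [a, b, c, d] xs \<Longrightarrow> subseq [a, b, c] xs \<and> subseq [b, c, d] xs \<and> subseq [a, c, d] xs \<and> subseq [a, b, d] xs"
  by (induction xs) (auto simp: subseq_simps dest: subseq3_pairs)

text \<open>Used to discard those alternatives of the append rules that place an entry in a block
  where it does not occur.\<close>

lemma not_subseqI: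
  "a \<notin> set xs \<or> b \<notin> set xs \<Longrightarrow> \<not> subseq [a, b] xs"
  "a \<notin> set xs \<or> b \<notin> set xs \<or> c \<notin> set xs \<Longrightarrow> \<not> subseq [a, b, c] xs"
  "a \<notin> set xs \<or> b \<notin> set xs \<or> c \<notin> set xs \<or> d \<notin> set xs \<Longrightarrow> \<not> subseq [a, b, c, d] xs"
  by (meson subseq2_set subseq3_pairs subseq4_triples)+

text \<open>
  Since entries are distinct, the first conjunct of \<open>not_triple_pattern\<close> excludes 3412 and 3421 at
  once.
\<close>

definition not_231 :: "nat \<Rightarrow> nat \<Rightarrow> nat \<Rightarrow> bool" where
  "not_231 a b c \<longleftrightarrow> \<not> (c < a \<and> a < b)"

definition not_triple_pattern :: "nat \<Rightarrow> nat \<Rightarrow> nat \<Rightarrow> nat \<Rightarrow> bool" where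
  "not_triple_pattern a b c d \<longleftrightarrow> \<not> (c < a \<and> d < a \<and> a < b) \<and> \<not> (b < a \<and> a < d \<and> d < c)"

definition triple_free :: "nat list \<Rightarrow> bool" where
  "triple_free p \<longleftrightarrow> (\<forall>a b c d. subseq [a, b, c, d] p \<longrightarrow> not_triple_pattern a b c d)"

text \<open>Both 3412 and 3421 contain 231, so this is avoidance of 231 and 2143.\<close>

definition free_231_2143 :: "nat list \<Rightarrow> bool" where
  "free_231_2143 p \<longleftrightarrow> triple_free p \<and> (\<forall>a b c. subseq [a, b, c] p \<longrightarrow> not_231 a b c)"

text \<open>The last entry does not play the role of 3 in an occurrence of 213.\<close>

definition triple_free_last :: "nat list \<Rightarrow> bool" where
  "triple_free_last p \<longleftrightarrow> triple_free p \<and> sorted (filter (\<lambda>x. x < last p) p)"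

text \<open>An occurrence consists of four entries, so each pattern becomes a chain of inequalities.
  The patterns 3412 and 3421 differ only in the order of the last two entries and merge into one
  condition once these are known to be different.\<close>

lemma triple_free_iff_avoids:
  assumes "distinct p"
  shows "(\<forall>\<tau>\<in>{[3,4,1,2], [3,4,2,1], [2,1,4,3]}. avoids p \<tau>) \<longleftrightarrow> triple_free p"
proof -
  have len: "(\<exists>s. subseq s p \<and> order_isomorphic s [x0, x1, x2, x3]) \<longleftrightarrow>
      (\<exists>a b c d. subseq [a, b, c, d] p \<and> order_isomorphic [a, b, c, d] [x0, x1, x2, x3])"
    for x0 x1 x2 x3
  proof -
    have "\<exists>a b c d. s = [a, b, c, d]" if "order_isomorphic s [x0, x1, x2, x3]" for s
    proof -
      have "length s = Suc (Suc (Suc (Suc 0)))"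
        using that by (simp add: order_isomorphic_def)
      then show ?thesis by (auto simp: length_Suc_conv)
    qed
    then show ?thesis by blast
  qed
  have 1: "order_isomorphic [a,b,c,d] [3,4,1,2] \<longleftrightarrow> c < d \<and> d < a \<and> a < b" for a b c d
    unfolding order_isomorphic_def
    by (auto simp: All_less_Suc numeral_eq_Suc)
  have 2: "order_isomorphic [a,b,c,d] [3,4,2,1] \<longleftrightarrow> d < c \<and> c < a \<and> a < b" for a b c d
    unfolding order_isomorphic_def
    by (auto simp: All_less_Suc numeral_eq_Suc)
  have 3: "order_isomorphic [a,b,c,d] [2,1,4,3] \<longleftrightarrow> b < a \<and> a < d \<and> d < c" for a b c d
    unfolding order_isomorphic_def
    by (auto simp: All_less_Suc numeral_eq_Suc)
  have neq: "c \<noteq> d" if "subseq [a,b,c,d] p" for a b c d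
    using subseq3_pairs[of b c d p] subseq4_triples[OF that] subseq2_distinct[OF _ assms] by blast
  have "not_triple_pattern a b c d \<longleftrightarrow>
      \<not> (c < d \<and> d < a \<and> a < b) \<and> \<not> (d < c \<and> c < a \<and> a < b) \<and> \<not> (b < a \<and> a < d \<and> d < c)"
    if "subseq [a,b,c,d] p" for a b c d
    using neq[OF that] by (auto simp: not_triple_pattern_def)
  then have "triple_free p \<longleftrightarrow> (\<forall>a b c d. subseq [a,b,c,d] p \<longrightarrow>
      \<not> (c < d \<and> d < a \<and> a < b) \<and> \<not> (d < c \<and> c < a \<and> a < b) \<and> \<not> (b < a \<and> a < d \<and> d < c))"
    unfolding triple_free_def by (simp cong: imp_cong)
  then show ?thesis
    by (simp only: avoids_def len 1 2 3 ball_simps Set.insert_iff) blast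
qed

lemma triple_free_Cons:
  "triple_free (x # q) \<longleftrightarrow> triple_free q \<and> (\<forall>b c d. subseq [b, c, d] q \<longrightarrow> not_triple_pattern x b c d)"
  unfolding triple_free_def subseq_Cons_right by blast

lemma free_231_2143_Cons:
  "free_231_2143 (x # q) \<longleftrightarrow> triple_free (x # q) \<and> free_231_2143 q \<and> (\<forall>b c. subseq [b, c] q \<longrightarrow> not_231 x b c)"
  unfolding free_231_2143_def triple_free_Cons subseq_Cons_right by blast

lemma triple_free_subseq: "triple_free p \<Longrightarrow> subseq q p \<Longrightarrow> triple_free q"
  unfolding triple_free_def by (meson subseq_order.trans)

lemma free_231_2143_subseq: "free_231_2143 p \<Longrightarrow> subseq q p \<Longrightarrow> free_231_2143 q"
  unfolding free_231_2143_def by (meson triple_free_subseq subseq_order.trans)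

text \<open>The first letter of 3412, 3421 and 2143 is never the smallest one, so a leading minimum
  takes part in no occurrence.\<close>

lemma triple_free_Cons_Suc0:
  assumes "\<forall>x\<in>set q. 0 < x"
  shows "triple_free (Suc 0 # q) \<longleftrightarrow> triple_free q"
proof -
  have "not_triple_pattern (Suc 0) b c d" if "subseq [b, c, d] q" for b c d
    using subseq3_pairs[OF that] subseq2_set[of b c q] assms by (simp add: not_triple_pattern_def)
  then show ?thesis by (auto simp only: triple_free_Cons)
qed

lemma free_231_2143_Cons_Suc0:
  assumes "\<forall>x\<in>set q. 0 < x"
  shows "free_231_2143 (Suc 0 # q) \<longleftrightarrow> free_231_2143 q"
proof -
  have "not_231 (Suc 0) b c" if "subseq [b, c] q" for b c
    using subseq2_set[OF that] assms by (simp add: not_231_def)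
  moreover have "free_231_2143 q \<Longrightarrow> triple_free q" by (simp add: free_231_2143_def)
  ultimately show ?thesis by (auto simp only: free_231_2143_Cons triple_free_Cons_Suc0[OF assms])
qed

section \<open>Invariance under adding a constant to all entries\<close>

lemma subseq_map_iff:
  "subseq xs (map f ys) \<longleftrightarrow> (\<exists>zs. xs = map f zs \<and> subseq zs ys)"
proof
  assume "subseq xs (map f ys)"
  then show "\<exists>zs. xs = map f zs \<and> subseq zs ys"
    by (auto simp: subseq_conv_nths nths_map)
qed (auto intro: subseq_map)

lemma subseq3_map_iff:
  "subseq [a, b, c] (map f p) \<longleftrightarrow>
     (\<exists>a' b' c'. a = f a' \<and> b = f b' \<and> c = f c' \<and> subseq [a', b', c'] p)"
  unfolding subseq_map_iff by (auto simp: Cons_eq_map_conv) blast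

lemma subseq4_map_iff:
  "subseq [a, b, c, d] (map f p) \<longleftrightarrow>
     (\<exists>a' b' c' d'. a = f a' \<and> b = f b' \<and> c = f c' \<and> d = f d' \<and> subseq [a', b', c', d'] p)"
  unfolding subseq_map_iff by (auto simp: Cons_eq_map_conv) blast

lemma triple_free_map_add [simp]: "triple_free (map (\<lambda>x. x + k) p) \<longleftrightarrow> triple_free p"
proof -
  have "not_triple_pattern (a + k) (b + k) (c + k) (d + k) \<longleftrightarrow> not_triple_pattern a b c d" for a b c d
    by (simp add: not_triple_pattern_def)
  then show ?thesis unfolding triple_free_def subseq4_map_iff by metis
qed

lemma free_231_2143_map_add [simp]: "free_231_2143 (map (\<lambda>x. x + k) p) \<longleftrightarrow> free_231_2143 p"
proof -
  have "not_231 (a + k) (b + k) (c + k) \<longleftrightarrow> not_231 a b c" for a b c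
    by (simp add: not_231_def)
  then show ?thesis unfolding free_231_2143_def triple_free_map_add subseq3_map_iff by metis
qed

lemma triple_free_last_map_add [simp]:
  assumes "p \<noteq> []"
  shows "triple_free_last (map (\<lambda>x. x + k) p) \<longleftrightarrow> triple_free_last p"
  using assms by (simp add: triple_free_last_def last_map filter_map o_def sorted_map)

section \<open>Decomposition by the first entry\<close>

text \<open>The first equation makes the later insertion map injective; both identify the value sets
  of the pieces.\<close>

lemma filter_insert_top:
  fixes t s :: nat
  assumes "\<forall>x\<in>set xs. x < t" "s < t" "\<forall>x\<in>set (ys @ zs). t < x"
  shows "filter (\<lambda>x. x < t) (t # xs @ ys @ s # zs) = xs @ [s]"
    and "filter (\<lambda>x. t < x) (t # xs @ ys @ s # zs) = ys @ zs"
proof -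
  have "filter (\<lambda>x. x < t) xs = xs" "filter (\<lambda>x. t < x) ys = ys" "filter (\<lambda>x. t < x) zs = zs"
    using assms by (simp_all add: filter_id_conv)
  moreover have "filter (\<lambda>x. t < x) xs = []" "filter (\<lambda>x. x < t) ys = []" "filter (\<lambda>x. x < t) zs = []"
    using assms by (simp_all add: filter_empty_conv not_less less_imp_le)
  ultimately show "filter (\<lambda>x. x < t) (t # xs @ ys @ s # zs) = xs @ [s]"
    "filter (\<lambda>x. t < x) (t # xs @ ys @ s # zs) = ys @ zs"
    using assms(2) by simp_all
qed

text \<open>The large entries increase, and \<open>s\<close> is the only small entry behind any of
  them. Hence 3412 and 3421 can occur only among the small entries. A 2143 that uses a large entry
  must use one of \<open>ys\<close> as 4 and \<open>s\<close> as 3, with 21 a descent below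
  \<open>s\<close> in \<open>xs\<close>.\<close>

lemma triple_free_insert_top:
  assumes "\<forall>x\<in>set xs. x < t" "s < t" "\<forall>x\<in>set (ys @ zs). t < x" "sorted (ys @ zs)"
  shows "triple_free (t # xs @ ys @ s # zs) \<longleftrightarrow>
    triple_free (xs @ [s]) \<and> (ys = [] \<or> sorted (filter (\<lambda>x. x < s) xs))" (is "?L \<longleftrightarrow> ?R")
proof
  let ?P = "t # xs @ ys @ s # zs"
  assume L: ?L
  have flt: "filter (\<lambda>x. x < t) ?P = xs @ [s]"
    using filter_insert_top[OF assms(1-3)] by blast
  have "triple_free (filter (\<lambda>x. x < t) ?P)"
    by (rule triple_free_subseq[OF L subseq_filter_left])
  then have "triple_free (xs @ [s])"
    by (simp only: flt)
  moreover have "sorted (filter (\<lambda>x. x < s) xs)" if "y \<in> set ys" for y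
    unfolding sorted_iff_subseq
  proof (intro allI impI)
    fix a b assume ab: "subseq [a,b] (filter (\<lambda>x. x < s) xs)"
    then have "subseq [a,b] xs" by (meson subseq_filter_left subseq_order.trans)
    \<comment> \<open>If \<open>a > b\<close>, then \<open>a\<close>, \<open>b\<close>,
      \<open>y\<close>, \<open>s\<close> would be an occurrence of 2143.\<close>
    then have "subseq [a,b,y,s] ?P"
      using that by (simp add: subseq_simps)
    then have "not_triple_pattern a b y s" using L unfolding triple_free_def by blast
    moreover have "a < s" "b < s" using subseq2_set[OF ab] by simp_all
    moreover have "s < y" using that assms(2,3) by (auto intro: less_trans)
    ultimately show "a \<le> b" unfolding not_triple_pattern_def by linarith
  qed
  ultimately show ?R by (cases ys) auto
next
  let ?P = "t # xs @ ys @ s # zs"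
  assume R: ?R
  have big: "e \<le> f" if "subseq [e, f] ?P" "t < e" "t < f" for e f
  proof -
    have "filter (\<lambda>x. t < x) ?P = ys @ zs"
      using filter_insert_top[OF assms(1-3)] by blast
    then have "subseq [e, f] (ys @ zs)"
      using subseq_filter[OF that(1), of "\<lambda>x. t < x"] that(2,3) by simp
    then show ?thesis using assms(4) sorted_iff_subseq by blast
  qed
  have small: "not_triple_pattern a b c d" if "subseq [a, b, c, d] ?P" "a < t" "b < t" "c < t" "d < t" for a b c d
  proof -
    have "filter (\<lambda>x. x < t) ?P = xs @ [s]"
      using filter_insert_top[OF assms(1-3)] by blast
    then have "subseq [a, b, c, d] (xs @ [s])"
      using subseq_filter[OF that(1), of "\<lambda>x. x < t"] that(2-) by simp
    then show ?thesis using R unfolding triple_free_def by blast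
  qed
  have top: "t \<notin> set (xs @ ys @ s # zs)"
    using assms(1-3) by auto
  have small_notin: "e \<notin> set (ys @ zs)" if "e < t" for e
    using that assms(3) less_asym by blast
  have not_t: "f \<noteq> t" if "subseq [e, f] ?P" for e f
    using that top subseq2_set[of e f "xs @ ys @ s # zs"] unfolding subseq_Cons_right(2)[of e _ t] subseq_singleton_left by metis
  \<comment> \<open>This rules out a large entry as the 4 of 3412 or 3421: behind it only
    \<open>s\<close> is small.\<close>
  have one_small: "\<not> (f < t \<and> g < t)" if "subseq [e, f, g] ?P" "t < e" for e f g
  proof
    assume fg: "f < t \<and> g < t"
    have "e \<noteq> t" "e \<notin> set xs" "e \<noteq> s" "f \<notin> set (ys @ zs)" "g \<notin> set (ys @ zs)"
      using that(2) fg small_notin assms(1-2) by auto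
    then show False
      using that(1) by (simp add: subseq_simps not_subseqI)
  qed
  \<comment> \<open>A 2143 mixing both sizes has a large 4 and a small 3; the 3 must then be
    \<open>s\<close>, and the 4 lies in \<open>ys\<close>.\<close>
  have last_small: "subseq [a, b] (filter (\<lambda>x. x < s) xs) \<and> d = s \<and> ys \<noteq> []"
    if "subseq [a, b, c, d] ?P" "b < a" "a < d" "d < t" "t < c" for a b c d
  proof -
    have m: "a \<noteq> t" "a \<notin> set (ys @ zs)" "b \<noteq> t" "b \<notin> set (ys @ zs)" "c \<noteq> t" "c \<noteq> s"
      "c \<notin> set xs" "d \<noteq> t" "d \<notin> set (ys @ zs)"
      using that(2-) small_notin[of a] small_notin[of b] small_notin[of d] assms(1-2) by auto
    have "subseq [a, b] xs \<and> d = s \<and> ys \<noteq> []"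
      using that(1) m by (auto simp add: subseq_simps not_subseqI)
    then show ?thesis
      using subseq_filter[of "[a, b]" xs "\<lambda>x. x < s"] that(2,3) by auto
  qed
  show ?L unfolding triple_free_def
  proof (intro allI impI)
    fix a b c d assume sub: "subseq [a, b, c, d] ?P"
    have tr: "subseq [a, b, c] ?P" "subseq [b, c, d] ?P" "subseq [a, c, d] ?P"
      using subseq4_triples[OF sub] by (auto simp only:)
    note pr = subseq3_pairs[OF tr(1)] subseq3_pairs[OF tr(2)] subseq3_pairs[OF tr(3)]
    have neq: "b \<noteq> t" "c \<noteq> t" "d \<noteq> t" using pr not_t by metis+
    have "\<not> (c < a \<and> d < a \<and> a < b)"
    proof
      assume A: "c < a \<and> d < a \<and> a < b"
      \<comment> \<open>A large \<open>c\<close> or \<open>d\<close> would have the larger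
        \<open>a\<close> before it, against the increasing order above \<open>t\<close>.\<close>
      have "\<not> t < c" using big[of a c] pr A by linarith
      moreover have "\<not> t < d" using big[of a d] pr A by linarith
      ultimately have cd: "c < t" "d < t" using neq by auto
      then have "\<not> t < b" using one_small[OF tr(2)] by blast
      then show False using small[OF sub] cd neq A by (auto simp: not_triple_pattern_def)
    qed
    moreover have "\<not> (b < a \<and> a < d \<and> d < c)"
    proof
      assume A: "b < a \<and> a < d \<and> d < c"
      have "\<not> t < d" using big[of d c] big[of c d] pr A by linarith
      then have d: "d < t" using neq by auto
      show False
      proof (cases "t < c")
        case True
        then have "subseq [a, b] (filter (\<lambda>x. x < s) xs)" "ys \<noteq> []"
          using last_small[OF sub] A d by auto
        then show False using R A unfolding sorted_iff_subseq by force
      next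
        case False
        then show False using small[OF sub] d neq A by (auto simp: not_triple_pattern_def)
      qed
    qed
    ultimately show "not_triple_pattern a b c d" unfolding not_triple_pattern_def by blast
  qed
qed

lemma subseq3_set: "subseq [a, b, c] xs \<Longrightarrow> a \<in> set xs \<and> b \<in> set xs \<and> c \<in> set xs"
  by (meson subseq2_set subseq3_pairs)

lemma subseq4_set:
  "subseq [a, b, c, d] xs \<Longrightarrow> a \<in> set xs \<and> b \<in> set xs \<and> c \<in> set xs \<and> d \<in> set xs"
  by (meson subseq3_set subseq4_triples)

lemma subseq_delete: "subseq (ys @ zs) (cs @ ys @ s # zs)"
proof -
  have "subseq zs (s # zs)" by (rule list_emb_Cons) simp
  then have "subseq (ys @ zs) (ys @ s # zs)" by (simp only: subseq_append')
  then show ?thesis by (rule list_emb_append2)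
qed

text \<open>Two smaller entries behind a larger one would, with \<open>t\<close> in front, violate
  the merged condition for 3412 and 3421, so at most one small entry lies behind a large one. As two
  small entries exist, one directly follows \<open>t\<close>; these two act as 21 and force the
  large entries to increase.\<close>

lemma triple_free_Cons_decomp:
  assumes triple_free: "triple_free (t # q)" and t: "t \<notin> set q"
    and uv: "u \<in> set q" "v \<in> set q" "u \<noteq> v" "u < t" "v < t"
  obtains xs ys s zs where "q = xs @ ys @ s # zs" "xs \<noteq> []" "\<forall>x\<in>set xs. x < t" "s < t"
    "\<forall>x\<in>set (ys @ zs). t < x" "sorted (ys @ zs)"
proof -
  define l where "l = takeWhile (\<lambda>x. x < t) q"
  define r where "r = dropWhile (\<lambda>x. x < t) q"
  have q: "q = l @ r" and l: "\<forall>x\<in>set l. x < t"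
    by (auto simp: l_def r_def dest: set_takeWhileD)
  have hd_r: "\<not> hd r < t" if "r \<noteq> []"
    using that unfolding r_def by (rule hd_dropWhile)
  have gt: "t < x" if "x \<in> set q" "\<not> x < t" for x
    using that t by (metis linorder_neqE_nat)
  have ok: "not_triple_pattern t b c d" if "subseq [b, c, d] q" for b c d
    using triple_free that by (simp add: triple_free_Cons)
  have srt: "sorted (ys @ zs)"
    if "q = c # cs @ ys @ s # zs" "c < t" "\<forall>x\<in>set (ys @ zs). t < x" for c cs ys s zs
    unfolding sorted_iff_subseq
  proof (intro allI impI)
    fix d e assume de: "subseq [d, e] (ys @ zs)"
    have "subseq (ys @ zs) (cs @ ys @ s # zs)"
      by (rule subseq_delete)
    then have "subseq [c, d, e] q"
      using de subseq_order.trans that(1) by (metis subseq_Cons2)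
    then show "d \<le> e" using ok[of c d e] that(2,3) subseq2_set[OF de] unfolding not_triple_pattern_def
      by (meson not_less)
  qed
  show thesis
  proof (cases "\<exists>s\<in>set r. s < t")
    \<comment> \<open>All small entries come first, so \<open>s\<close> is the last of them and
      \<open>ys\<close> is empty.\<close>
    case False
    then have big: "\<forall>x\<in>set r. t < x" using gt q by auto
    then have u: "u \<in> set l" and v: "v \<in> set l"
      using uv q by (auto dest: bspec less_asym)
    then obtain xs s where xs: "l = xs @ [s]" by (cases l rule: rev_cases) auto
    then have "xs \<noteq> []" using u v uv(3) by auto
    then obtain c cs where "xs = c # cs" by (cases xs) auto
    then have "sorted ([] @ r)"
      using srt[of c cs "[]" s r] big l q xs by simp
    then show thesis
      using that[of xs "[]" s r] \<open>xs \<noteq> []\<close> big l q xs by simp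
  next
    case True
    then obtain ys s zs where r: "r = ys @ s # zs" and s: "s < t" and ys: "\<forall>y\<in>set ys. \<not> y < t"
      using split_list_first_prop[of r "\<lambda>x. x < t"] by blast
    \<comment> \<open>\<open>dropWhile\<close> stops at an entry that is not small, hence a large
      \<open>y\<close> precedes \<open>s\<close>.\<close>
    have "ys \<noteq> []" using hd_r r s by (cases ys) auto
    then obtain y ys' where y: "ys = y # ys'" by (cases ys) auto
    then have "t < y" using gt[of y] q r ys by auto
    have "\<not> z < t" if "z \<in> set zs" for z
    proof
      assume "z < t"
      \<comment> \<open>\<open>t\<close>, \<open>y\<close>, \<open>s\<close>, \<open>z\<close> would
        play 34 followed by two smaller entries.\<close>
      have "subseq [y, s, z] q"
        using that by (simp add: q r y subseq_simps)
      then show False using ok \<open>t < y\<close> s \<open>z < t\<close> unfolding not_triple_pattern_def by blast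
    qed
    then have big: "\<forall>x\<in>set (ys @ zs). t < x" using gt q r ys by auto
    then have "\<forall>x\<in>set (ys @ zs). \<not> x < t" by (meson less_asym)
    \<comment> \<open>At most one of \<open>u\<close> and \<open>v\<close> is \<open>s\<close>, and
      the other can only lie in \<open>l\<close>.\<close>
    then have "u \<in> set l \<or> v \<in> set l" using uv q r by auto
    then obtain c cs where c: "l = c # cs" by (cases l) auto
    then have "sorted (ys @ zs)"
      using srt[of c cs ys s zs] big l q r by simp
    then show thesis
      using that[of l ys s zs] big l q r s c by simp
  qed
qed

text \<open>A 231 in \<open>ys @ zs\<close> whose letters 23 precede the entry 1 extends by it to
  3412 or 3421. The entries 2, 1 act as the 21 of a 2143 for every descent in \<open>zs\<close>,
  which also excludes a 231 whose 3 lies in \<open>zs\<close>.\<close>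

lemma triple_free_two_one:
  assumes gt: "\<forall>x\<in>set (ys @ zs). 2 < x"
  shows "triple_free (2 # ys @ 1 # zs) \<longleftrightarrow> free_231_2143 (ys @ zs) \<and> sorted zs" (is "triple_free ?P \<longleftrightarrow> _")
proof
  assume L: "triple_free ?P"
  have "subseq (ys @ zs) ?P"
    using subseq_delete[of ys zs "[2]" 1] by (simp only: append_Cons append_Nil)
  then have "triple_free (ys @ zs)" using L triple_free_subseq by blast
  moreover have sorted: "sorted zs" unfolding sorted_iff_subseq
  proof (intro allI impI)
    fix d e assume de: "subseq [d, e] zs"
    then have "subseq [2, 1, d, e] ?P" by (simp add: subseq_simps)
    then have "not_triple_pattern 2 1 d e" using L unfolding triple_free_def by blast
    then show "d \<le> e" using gt subseq2_set[OF de] by (auto simp: not_triple_pattern_def)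
  qed
  moreover have "not_231 a b c" if abc: "subseq [a, b, c] (ys @ zs)" for a b c
  proof -
    have a: "2 < a" using gt subseq3_set[OF abc] by blast
    consider "subseq [a, b] ys" "c \<in> set zs" | "subseq [a, b, c] ys" | "subseq [b, c] zs"
      using abc subseq3_pairs[of a b c zs] unfolding subseq3_append by blast
    then show ?thesis
    proof cases
      case 1
      then have "subseq [a, b, 1, c] ?P" by (simp add: subseq_simps)
      then have "not_triple_pattern a b 1 c" using L unfolding triple_free_def by blast
      then show ?thesis using a by (auto simp: not_triple_pattern_def not_231_def)
    next
      case 2
      then have "subseq [a, b, c, 1] ?P" by (simp add: subseq_simps)
      then have "not_triple_pattern a b c 1" using L unfolding triple_free_def by blast
      then show ?thesis using a by (auto simp: not_triple_pattern_def not_231_def)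
    next
      case 3
      then have "b \<le> c" using sorted sorted_iff_subseq by blast
      then show ?thesis by (simp add: not_231_def)
    qed
  qed
  ultimately show "free_231_2143 (ys @ zs) \<and> sorted zs" unfolding free_231_2143_def by blast
next
  assume R: "free_231_2143 (ys @ zs) \<and> sorted zs"
  have notin: "1 \<notin> set ys" "1 \<notin> set zs" using bspec[OF gt, of 1] by auto
  have pos: "\<forall>x\<in>set (ys @ 1 # zs). 0 < x" using gt by auto
  have zs: "d \<le> e" if "subseq [d, e] zs" for d e
    using R that sorted_iff_subseq by blast
  have not_231: "not_231 a b c" if "subseq [a, b, c] (ys @ zs)" for a b c
    using R that unfolding free_231_2143_def by blast
  \<comment> \<open>Only the entry 1 is smaller than the leading 2, so the latter is no 3 of a
    pattern. As the 2 of 2143 it needs the entry 1 next and then a descent in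
    \<open>zs\<close>.\<close>
  have 2: "not_triple_pattern 2 b c d" if "subseq [b, c, d] (ys @ 1 # zs)" for b c d
  proof -
    have mem: "b = 1 \<or> 2 < b" "c = 1 \<or> 2 < c" "d = 1 \<or> 2 < d"
      using subseq3_set[OF that] gt by auto
    have "\<not> (c = 1 \<and> d = 1)"
      using that notin by (auto simp: subseq_simps not_subseqI)
    moreover have "c \<le> d" if "b = 1"
    proof -
      have "subseq [c, d] zs"
        using \<open>subseq [b, c, d] (ys @ 1 # zs)\<close> notin that by (simp add: subseq_simps not_subseqI)
      then show ?thesis by (rule zs)
    qed
    ultimately show ?thesis using mem by (auto simp: not_triple_pattern_def)
  qed
  have "not_triple_pattern a b c d" if abcd: "subseq [a, b, c, d] (ys @ 1 # zs)" for a b c d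
  proof -
    have mem: "0 < a \<and> 0 < b \<and> 0 < c \<and> 0 < d"
      using subseq4_set[OF abcd] pos by blast
    \<comment> \<open>As second letter the entry 1 belongs to a 2143 and leaves a descent in
      \<open>zs\<close>; as third or fourth letter it belongs to 3412 or 3421 and leaves a 231
      without it.\<close>
    consider "a = 1" | "a \<noteq> 1" "b = 1" | "a \<noteq> 1" "b \<noteq> 1" "c = 1"
      | "a \<noteq> 1" "b \<noteq> 1" "c \<noteq> 1" "d = 1" | "a \<noteq> 1" "b \<noteq> 1" "c \<noteq> 1" "d \<noteq> 1"
      by blast
    then show ?thesis
    proof cases
      case 1
      then show ?thesis using mem by (simp add: not_triple_pattern_def)
    next
      case 2
      then have "subseq [c, d] zs"
        using abcd notin by (simp add: subseq_simps not_subseqI)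
      then show ?thesis using zs[of c d] 2 mem by (simp add: not_triple_pattern_def)
    next
      case 3
      then have "subseq [a, b, d] (ys @ zs)"
        using abcd notin by (simp add: subseq_simps not_subseqI)
      then show ?thesis using not_231[of a b d] 3 mem by (auto simp: not_triple_pattern_def not_231_def)
    next
      case 4
      then have "subseq [a, b, c] (ys @ zs)"
        using abcd notin by (simp add: subseq_simps not_subseqI)
      then show ?thesis using not_231[of a b c] 4 mem by (auto simp: not_triple_pattern_def not_231_def)
    next
      case 5
      then have "subseq [a, b, c, d] (ys @ zs)"
        using abcd by (auto simp: subseq_simps)
      then show ?thesis using R unfolding free_231_2143_def triple_free_def by blast
    qed
  qed
  then have "triple_free (ys @ 1 # zs)" unfolding triple_free_def by blast
  then show "triple_free ?P" unfolding triple_free_Cons using 2 by blast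
qed

text \<open>With \<open>t\<close>, the first entry of \<open>xs\<close> turns every descent in
  \<open>zs\<close> into a 2143. Conversely, a 231 whose 2 is at least \<open>t\<close> needs a
  descent in \<open>zs\<close>, and one whose 2 is smaller lies entirely in
  \<open>xs\<close>.\<close>

lemma free_231_2143_insert_top:
  assumes "xs \<noteq> []" "\<forall>x\<in>set xs. x < t" "\<forall>x\<in>set zs. t < x"
  shows "free_231_2143 (t # xs @ zs) \<longleftrightarrow> free_231_2143 xs \<and> sorted zs" (is "free_231_2143 ?P \<longleftrightarrow> _")
proof
  assume L: "free_231_2143 ?P"
  have "subseq xs ?P" 
    by (intro list_emb_Cons subseq_rev_drop_many subseq_order.order_refl)
  then have "free_231_2143 xs" using L free_231_2143_subseq by blast
  moreover have "sorted zs" unfolding sorted_iff_subseq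
  proof (intro allI impI)
    fix d e assume de: "subseq [d, e] zs"
    then have "subseq [t, hd xs, d, e] ?P" using assms(1) by (simp add: subseq_simps)
    then have "not_triple_pattern t (hd xs) d e" using L unfolding free_231_2143_def triple_free_def by blast
    then show "d \<le> e" using assms(2,3) hd_in_set[OF assms(1)] subseq2_set[OF de]
      unfolding not_triple_pattern_def by (meson not_less)
  qed
  ultimately show "free_231_2143 xs \<and> sorted zs" ..
next
  assume R: "free_231_2143 xs \<and> sorted zs"
  obtain xs' s where xs: "xs = xs' @ [s]" using assms(1) by (cases xs rule: rev_cases) auto
  \<comment> \<open>The case of an empty middle block: all of \<open>zs\<close> follows the last
    entry of \<open>xs\<close>.\<close>
  have "triple_free ?P"
    using triple_free_insert_top[of xs' t s "[]" zs] assms(2,3) R by (simp add: xs free_231_2143_def)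
  moreover have "not_231 a b c" if abc: "subseq [a, b, c] ?P" for a b c
  proof (rule ccontr)
    assume "\<not> not_231 a b c"
    then have less: "c < a" "a < b" by (auto simp: not_231_def)
    have zs: "x \<le> c" if "subseq [x, c] zs" for x
      using R that sorted_iff_subseq by blast
    have t: "t \<notin> set xs" "t \<notin> set zs" using assms(2,3) by auto
    consider "t < a" | "a = t" | "a < t" by linarith
    then show False
    proof cases
      case 1
      then have "a \<noteq> t" "a \<notin> set xs" using assms(2) by auto
      then have "subseq [a, c] zs"
        using subseq3_pairs[OF abc] by (simp add: subseq_simps not_subseqI)
      then show False using zs[of a] less by simp
    next
      case 2
      then have "b \<noteq> t" "b \<notin> set xs" using less assms(2) by auto
      then have "subseq [b, c] zs"
        using subseq3_pairs[OF abc] by (simp add: subseq_simps not_subseqI)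
      then show False using zs[of b] less by simp
    next
      case 3
      then have "a \<noteq> t" "a \<notin> set zs" "c \<noteq> t" "c \<notin> set zs" using less assms(3) by auto
      then have "subseq [a, b, c] xs"
        using abc by (simp add: subseq_simps not_subseqI)
      then have "not_231 a b c" using R unfolding free_231_2143_def by blast
      then show False using less by (simp add: not_231_def)
    qed
  qed
  ultimately show "free_231_2143 ?P" by (simp add: free_231_2143_def)
qed

section \<open>Counting\<close>

text \<open>A weight \<open>h\<close> is carried along because \<open>num_splits\<close> is a
  weighted count; weight 1 gives cardinalities.\<close>

lemma sum_permutations_by_first:
  assumes "finite A" "A \<noteq> {}"
  shows "(\<Sum>p | p \<in> permutations_of_set A \<and> Q p. h p) =
    (\<Sum>a\<in>A. \<Sum>q | q \<in> permutations_of_set (A - {a}) \<and> Q (a # q). h (a # q))"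
proof -
  have "{p. p \<in> permutations_of_set A \<and> Q p} =
      (\<Union>a\<in>A. (#) a ` {q. q \<in> permutations_of_set (A - {a}) \<and> Q (a # q)})"
    using assms by (subst permutations_of_set_nonempty) auto
  also have "sum h \<dots> = (\<Sum>a\<in>A. sum h ((#) a ` {q. q \<in> permutations_of_set (A - {a}) \<and> Q (a # q)}))"
    using assms by (subst sum.UNION_disjoint) auto
  also have "\<dots> = (\<Sum>a\<in>A. \<Sum>q | q \<in> permutations_of_set (A - {a}) \<and> Q (a # q). h (a # q))"
    by (rule sum.cong[OF refl], subst sum.reindex) (auto simp: o_def)
  finally show ?thesis .
qed

lemma permutation_neq_Nil:
  assumes "p \<in> permutations_of_set A" "A \<noteq> {}"
  shows "p \<noteq> []"
  using permutations_of_setD(1)[OF assms(1)] assms(2) by auto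

lemma permutations_of_set_shift:
  "permutations_of_set {Suc k..n + k} = map (\<lambda>x. x + k) ` permutations_of_set {1..n}"
proof -
  have "{Suc k..n + k} = (\<lambda>x. x + k) ` {1..n}"
    by (simp add: image_add_atLeastAtMost')
  then show ?thesis
    by (simp only: permutations_of_set_image_inj[of "\<lambda>x. x + k" "{1..n}", OF inj_on_add'])
qed

lemma sum_permutations_shift:
  "(\<Sum>q | q \<in> permutations_of_set {Suc k..n + k} \<and> Q q. h q) =
    (\<Sum>p | p \<in> permutations_of_set {1..n} \<and> Q (map (\<lambda>x. x + k) p). h (map (\<lambda>x. x + k) p))"
proof -
  have "{q. q \<in> permutations_of_set {Suc k..n + k} \<and> Q q} =
      map (\<lambda>x. x + k) ` {p. p \<in> permutations_of_set {1..n} \<and> Q (map (\<lambda>x. x + k) p)}"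
    unfolding permutations_of_set_shift by auto
  moreover have "inj_on (map (\<lambda>x. x + k)) X" for X
    by (rule inj_on_subset[OF inj_mapI]) (auto simp: inj_def)
  ultimately show ?thesis by (simp add: sum.reindex)
qed

section \<open>Inserting the entries above the first entry\<close>

lemma sorted_eq_upt:
  assumes "sorted xs" "distinct xs" "set xs = {a..<b}"
  shows "xs = [a..<b]"
  by (rule sorted_distinct_set_unique) (use assms in auto)

lemma inj_insert_at:
  assumes "take i xs @ s # drop i xs = take j xs @ s # drop j xs" "s \<notin> set xs"
    "i \<le> length xs" "j \<le> length xs"
  shows "i = j"
proof -
  have tw: "takeWhile (\<lambda>x. x \<noteq> s) (take i xs @ s # drop i xs) = take i xs" for i
  proof -
    have "\<forall>x\<in>set (take i xs). x \<noteq> s" using assms(2) by (auto dest: in_set_takeD)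
    then show ?thesis by (simp add: takeWhile_append2)
  qed
  have "take i xs = take j xs" using tw[of i] tw[of j] assms(1) by simp
  then have "length (take i xs) = length (take j xs)" by simp
  then show ?thesis using assms(3,4) by simp
qed

text \<open>The block of entries above a first entry \<open>Suc k\<close>; the parameter
  \<open>k\<close> is the number of entries below it.\<close>

definition top_list :: "nat \<Rightarrow> nat \<Rightarrow> nat list" where
  "top_list k n = [Suc (Suc k)..<Suc n]"

lemma top_list_simps [simp]:
  "length (top_list k n) = n - Suc k" "set (top_list k n) = {Suc (Suc k)..n}"
  "sorted (top_list k n)" "distinct (top_list k n)"
  by (auto simp: top_list_def simp del: upt_Suc)

text \<open>In a pair \<open>(p, j)\<close>, \<open>p\<close> arranges the entries below
  \<open>Suc k\<close>, and \<open>j\<close> counts the larger entries placed before the last entry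
  of \<open>p\<close>. The first entry \<open>Suc k\<close> is prepended separately.\<close>

definition insert_tops :: "nat \<Rightarrow> nat \<Rightarrow> nat list \<times> nat \<Rightarrow> nat list" where
  "insert_tops k n = (\<lambda>(p, j).
     butlast p @ take j (top_list k n) @ last p # drop j (top_list k n))"

lemma set_take_drop: "set (take j xs) \<union> set (drop j xs) = set xs"
  by (metis append_take_drop_id set_append)

text \<open>For \<open>j = 0\<close> the block before the last entry of \<open>p\<close> is empty,
  so \<open>triple_free_insert_top\<close> asks only for \<open>triple_free p\<close>. The last
  equation recovers \<open>p\<close> for injectivity.\<close>

lemma insert_tops_triple_free:
  assumes p: "p \<in> permutations_of_set {1..k}" "p \<noteq> []" and j: "j \<le> n - Suc k"
  shows "triple_free (Suc k # insert_tops k n (p, j)) \<longleftrightarrow> triple_free p \<and> (j = 0 \<or> triple_free_last p)"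
    and "k < n \<Longrightarrow> insert_tops k n (p, j) \<in> permutations_of_set ({1..n} - {Suc k})"
    and "filter (\<lambda>x. x < Suc k) (Suc k # insert_tops k n (p, j)) = p"
proof -
  let ?B = "top_list k n"
  obtain xs s where xs: "p = xs @ [s]" using p(2) by (cases p rule: rev_cases) auto
  have set: "set xs \<union> {s} = {1..k}" and dist: "distinct (xs @ [s])"
    using permutations_of_setD[OF p(1)] xs by auto
  have big: "\<forall>x\<in>set (take j ?B @ drop j ?B). Suc k < x" by simp
  have "set xs \<subseteq> {1..k}" "s \<in> {1..k}" using set by blast+
  then have small: "\<forall>x\<in>set xs. x < Suc k" "s < Suc k" by auto
  have eq: "insert_tops k n (p, j) = xs @ take j ?B @ s # drop j ?B"
    by (simp add: insert_tops_def xs)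
  \<comment> \<open>The bound on \<open>j\<close> matters: it keeps \<open>take\<close> from
    truncating, so the block is empty only for \<open>j = 0\<close>.\<close>
  have "length (take j ?B) = j" using j by simp
  then have nil: "take j ?B = [] \<longleftrightarrow> j = 0" by (metis length_0_conv)
  have srt: "sorted (take j ?B @ drop j ?B)" by simp
  have g3: "triple_free_last p \<longleftrightarrow> triple_free p \<and> sorted (filter (\<lambda>x. x < s) xs)"
    by (simp add: triple_free_last_def xs)
  show "triple_free (Suc k # insert_tops k n (p, j)) \<longleftrightarrow> triple_free p \<and> (j = 0 \<or> triple_free_last p)"
    unfolding eq triple_free_insert_top[OF small big srt] nil g3 xs[symmetric] by blast
  show "filter (\<lambda>x. x < Suc k) (Suc k # insert_tops k n (p, j)) = p"
    unfolding eq filter_insert_top(1)[OF small big] by (rule xs[symmetric])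
  show "insert_tops k n (p, j) \<in> permutations_of_set ({1..n} - {Suc k})" if "k < n"
  proof (rule permutations_of_setI)
    have "set (insert_tops k n (p, j)) = (set xs \<union> {s}) \<union> set ?B"
      unfolding eq using set_take_drop[of j ?B] by (simp only: set_append set_simps) blast
    also have "\<dots> = {1..n} - {Suc k}"
      by (simp only: set top_list_simps) (use that in auto)
    finally show "set (insert_tops k n (p, j)) = {1..n} - {Suc k}" .
    have "set (xs @ [s]) \<inter> set ?B = {}" using small by auto
    then have "distinct ((xs @ [s]) @ (take j ?B @ drop j ?B))"
      using dist unfolding append_take_drop_id distinct_append[of "xs @ [s]"] by simp
    then show "distinct (insert_tops k n (p, j))"
      unfolding eq by (simp only: append_assoc append_Cons append_Nil distinct_append distinct.simps set_append set_simps) blast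
  qed
qed

text \<open>Surjectivity comes from \<open>triple_free_Cons_decomp\<close>, the converse from
  \<open>insert_tops_triple_free\<close>. The bound \<open>2 \<le> k\<close> supplies the two
  entries 1 and 2 below the first one.\<close>

lemma insert_tops_image:
  assumes k: "2 \<le> k" "k < n"
  shows "{q. q \<in> permutations_of_set ({1..n} - {Suc k}) \<and> triple_free (Suc k # q)} =
    insert_tops k n ` {(p, j). p \<in> permutations_of_set {1..k} \<and> j \<le> n - Suc k \<and>
      triple_free p \<and> (j = 0 \<or> triple_free_last p)}" (is "?L = _ ` ?X")
proof (intro equalityI subsetI)
  fix q assume "q \<in> ?L"
  then have q: "set q = {1..n} - {Suc k}" "distinct q" "triple_free (Suc k # q)"
    by (auto dest: permutations_of_setD)
  obtain xs ys s zs where d: "q = xs @ ys @ s # zs" "xs \<noteq> []" "\<forall>x\<in>set xs. x < Suc k" "s < Suc k"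
    "\<forall>x\<in>set (ys @ zs). Suc k < x" "sorted (ys @ zs)"
  proof (rule triple_free_Cons_decomp[OF q(3), of 1 2])
    show "Suc k \<notin> set q" "1 \<in> set q" "2 \<in> set q" "1 < Suc k" "2 < Suc k"
      using q(1) k by auto
  qed auto
  have "set (ys @ zs) = set (filter (\<lambda>x. Suc k < x) (Suc k # q))"
    unfolding d(1) filter_insert_top(2)[OF d(3,4,5)] ..
  also have "\<dots> = {Suc (Suc k)..n}"
    unfolding set_filter set_simps q(1) using k by auto
  finally have set_big: "set (ys @ zs) = {Suc (Suc k)..<Suc n}" by (simp add: atLeastLessThanSuc_atLeastAtMost)
  have dist: "distinct (ys @ zs)" "distinct (xs @ [s])" using q(2) d(1) by auto
  then have B: "ys @ zs = top_list k n"
    unfolding top_list_def by (intro sorted_eq_upt d(6) dist set_big)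
  have "set (xs @ [s]) = set (filter (\<lambda>x. x < Suc k) (Suc k # q))"
    unfolding d(1) filter_insert_top(1)[OF d(3,4,5)] ..
  also have "\<dots> = {1..k}"
    unfolding set_filter set_simps q(1) using k by auto
  finally have "set (xs @ [s]) = {1..k}" .
  then have p: "xs @ [s] \<in> permutations_of_set {1..k}"
    by (intro permutations_of_setI dist)
  have len: "length ys \<le> n - Suc k"
    using arg_cong[OF B, of length] by simp
  have eq: "q = insert_tops k n (xs @ [s], length ys)"
    using d(1) by (simp add: insert_tops_def B[symmetric])
  have "triple_free (Suc k # insert_tops k n (xs @ [s], length ys))"
    using q(3) unfolding eq .
  then have "triple_free (xs @ [s]) \<and> (length ys = 0 \<or> triple_free_last (xs @ [s]))"
    using insert_tops_triple_free(1)[OF p _ len] by simp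
  then have "(xs @ [s], length ys) \<in> ?X"
    using p len by simp
  then show "q \<in> insert_tops k n ` ?X" unfolding eq by (rule imageI)
next
  fix q assume "q \<in> insert_tops k n ` ?X"
  then obtain u where u: "u \<in> ?X" "q = insert_tops k n u" by (rule imageE)
  obtain p j where "u = (p, j)" by (cases u)
  then have pj: "p \<in> permutations_of_set {1..k}" "j \<le> n - Suc k" "triple_free p \<and> (j = 0 \<or> triple_free_last p)"
    and q: "q = insert_tops k n (p, j)"
    using u by simp_all
  have ne: "p \<noteq> []" using permutation_neq_Nil[OF pj(1)] k by simp
  have "triple_free (Suc k # q)"
    using insert_tops_triple_free(1)[OF pj(1) ne pj(2)] pj(3) unfolding q by blast
  moreover have "q \<in> permutations_of_set ({1..n} - {Suc k})"
    unfolding q by (rule insert_tops_triple_free(2)[OF pj(1) ne pj(2) k(2)])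
  ultimately show "q \<in> ?L" by blast
qed

text \<open>Selecting the entries below \<open>Suc k\<close> gives back \<open>p\<close>, and the
  place of its last entry among the larger ones gives back the cut.\<close>

lemma insert_tops_inj:
  assumes "0 < k"
  shows "inj_on (insert_tops k n) (permutations_of_set {1..k} \<times> {..n - Suc k})"
proof (rule inj_onI)
  fix u v assume uv: "u \<in> permutations_of_set {1..k} \<times> {..n - Suc k}"
    "v \<in> permutations_of_set {1..k} \<times> {..n - Suc k}" and eq: "insert_tops k n u = insert_tops k n v"
  obtain p i where u: "u = (p, i)" by fastforce
  obtain p' j where v: "v = (p', j)" by fastforce
  have p: "p \<in> permutations_of_set {1..k}" "p' \<in> permutations_of_set {1..k}"
    "i \<le> n - Suc k" "j \<le> n - Suc k"
    using uv u v by auto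
  have ne: "p \<noteq> []" "p' \<noteq> []"
    using permutation_neq_Nil[OF p(1)] permutation_neq_Nil[OF p(2)] assms by simp_all
  have pp: "p = p'"
    using insert_tops_triple_free(3)[OF p(1) ne(1) p(3)] insert_tops_triple_free(3)[OF p(2) ne(2) p(4)] eq
    by (simp only: u v)
  have "last p \<in> {1..k}"
    using last_in_set[OF ne(1)] permutations_of_setD(1)[OF p(1)] by blast
  then have "last p \<notin> set (top_list k n)" by simp
  then have "i = j"
    using inj_insert_at[of i "top_list k n" "last p" j] eq p by (simp add: u v pp insert_tops_def)
  then show "u = v" by (simp add: u v pp)
qed

lemma card_permutations_by_first:
  assumes "finite A" "A \<noteq> {}"
  shows "card {p. p \<in> permutations_of_set A \<and> Q p} =
    (\<Sum>a\<in>A. card {q. q \<in> permutations_of_set (A - {a}) \<and> Q (a # q)})"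
  using sum_permutations_by_first[OF assms, of "\<lambda>_. 1 :: nat" Q] by simp

lemma card_permutations_shift:
  "card {q. q \<in> permutations_of_set {Suc k..n + k} \<and> Q q} =
    card {p. p \<in> permutations_of_set {1..n} \<and> Q (map (\<lambda>x. x + k) p)}"
  using sum_permutations_shift[where h = "\<lambda>_. 1 :: nat" and k = k and n = n and Q = Q] by simp

section \<open>Recurrences for the permutations avoiding 231 and 2143 and for their cuts\<close>

lemma sum_first_Suc:
  "(\<Sum>a = 1..Suc m. f a) = f 1 + (\<Sum>k = 1..m. f (Suc k) :: nat)"
  by (induction m) simp_all

lemma diff_first: "{1..Suc m} - {1} = {Suc 1..m + 1}"
  by auto

text \<open>By \<open>triple_free_two_one\<close> these cuts are the admissible places for the entry
  1 in a permutation that begins with 2. The cut at the end always counts.\<close>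

definition splits :: "nat list \<Rightarrow> nat" where
  "splits p = card {j. j \<le> length p \<and> sorted (drop j p)}"

lemma splits_Nil [simp]: "splits [] = 1"
  by (simp add: splits_def)

lemma splits_Cons: "splits (x # xs) = splits xs + of_bool (sorted (x # xs))"
proof -
  have "{j. j \<le> length (x # xs) \<and> sorted (drop j (x # xs))} =
      Suc ` {j. j \<le> length xs \<and> sorted (drop j xs)} \<union> (if sorted (x # xs) then {0} else {})"
    (is "?A = Suc ` ?B \<union> ?C")
  proof (rule set_eqI)
    fix j show "j \<in> ?A \<longleftrightarrow> j \<in> Suc ` ?B \<union> ?C"
      by (cases j) (auto simp del: sorted_simps)
  qed
  moreover have "card (Suc ` ?B \<union> ?C) = card (Suc ` ?B) + card ?C"
    by (rule card_Un_disjoint) auto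
  ultimately show ?thesis by (simp add: splits_def card_image del: sorted_simps)
qed

text \<open>A cut inside \<open>xs\<close> keeps its status because \<open>zs\<close> is increasing
  and nowhere below \<open>xs\<close>; every entry of \<open>zs\<close> opens one further cut behind
  it.\<close>

lemma splits_append_top:
  assumes "sorted zs" "\<forall>x\<in>set xs. \<forall>z\<in>set zs. x \<le> z"
  shows "splits (xs @ zs) = splits xs + length zs"
  using assms(2)
proof (induction xs)
  case Nil
  show ?case using assms(1) by (induction zs) (simp_all add: splits_Cons)
next
  case (Cons x xs)
  then have "sorted (x # xs @ zs) \<longleftrightarrow> sorted (x # xs)"
    using assms(1) by (auto simp: sorted_append)
  then show ?case using Cons by (simp add: splits_Cons del: sorted_simps)
qed

lemma sorted_map_add [simp]: "sorted (map (\<lambda>x. x + k) p) \<longleftrightarrow> sorted (p :: nat list)"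
  by (simp add: sorted_map)

lemma splits_map_add [simp]: "splits (map (\<lambda>x. x + k) p) = splits p"
  by (simp add: splits_def drop_map)

definition num_triple_free :: "nat \<Rightarrow> nat" where
  "num_triple_free n = card {p. p \<in> permutations_of_set {1..n} \<and> triple_free p}"

definition num_free_231_2143 :: "nat \<Rightarrow> nat" where
  "num_free_231_2143 n = card {p. p \<in> permutations_of_set {1..n} \<and> free_231_2143 p}"

definition num_triple_free_last :: "nat \<Rightarrow> nat" where
  "num_triple_free_last n = card {p. p \<in> permutations_of_set {1..n} \<and> triple_free_last p}"

text \<open>This weighted sum counts the \<open>triple_free\<close> permutations of size
  \<open>n + 2\<close> that begin with 2, see \<open>card_triple_free_first_two\<close>.\<close>

definition num_splits :: "nat \<Rightarrow> nat" where
  "num_splits n = (\<Sum>p | p \<in> permutations_of_set {1..n} \<and> free_231_2143 p. splits p)"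

text \<open>Behind the leading \<open>Suc k\<close>, a larger entry followed by a smaller one would
  give 231, so the smaller entries come first. At least one exists and, with \<open>Suc k\<close>,
  forces the larger ones to increase.\<close>

lemma free_231_2143_tops_image:
  assumes k: "1 \<le> k" "k < n"
  shows "{q. q \<in> permutations_of_set ({1..n} - {Suc k}) \<and> free_231_2143 (Suc k # q)} =
    (\<lambda>p. p @ top_list k n) ` {p. p \<in> permutations_of_set {1..k} \<and> free_231_2143 p}" (is "?L = ?f ` ?X")
proof (intro equalityI subsetI)
  fix q assume "q \<in> ?L"
  then have q: "set q = {1..n} - {Suc k}" "distinct q" "free_231_2143 (Suc k # q)"
    by (auto dest: permutations_of_setD)
  define l where "l = takeWhile (\<lambda>x. x < Suc k) q"
  define r where "r = dropWhile (\<lambda>x. x < Suc k) q"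
  have lr: "q = l @ r" and l: "\<forall>x\<in>set l. x < Suc k"
    by (auto simp: l_def r_def dest: set_takeWhileD)
  have r: "\<forall>x\<in>set r. Suc k < x"
  proof (cases r)
    case (Cons y r')
    have "\<not> y < Suc k"
      using hd_dropWhile[of "\<lambda>x. x < Suc k" q] Cons unfolding r_def by simp
    have notin: "Suc k \<notin> set q" by (simp add: q(1))
    then have "y \<noteq> Suc k" using lr Cons by auto
    with \<open>\<not> y < Suc k\<close> have y: "Suc k < y" by simp
    have "Suc k < z" if "z \<in> set r'" for z
    proof -
      have "subseq [y, z] q" using that by (simp add: lr Cons subseq_simps)
      then have "not_231 (Suc k) y z" using q(3) unfolding free_231_2143_Cons by blast
      moreover have "z \<noteq> Suc k" using notin lr Cons that by auto
      ultimately show ?thesis using y by (simp add: not_231_def)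
    qed
    then show ?thesis using y Cons by simp
  qed simp
  have set_l: "set l = {1..k}"
  proof (intro equalityI subsetI)
    fix x assume x: "x \<in> set l"
    then have "x \<in> set q" using lr by simp
    then have "x \<in> {1..n}" unfolding q(1) by simp
    then show "x \<in> {1..k}" using bspec[OF l x] by simp
  next
    fix x assume x: "x \<in> {1..k}"
    then have "x \<in> set q" unfolding q(1) using k by simp
    moreover have "x \<notin> set r" using bspec[OF r, of x] x by auto
    ultimately show "x \<in> set l" using lr by simp
  qed
  have set_r: "set r = {Suc (Suc k)..<Suc n}"
  proof (intro equalityI subsetI)
    fix x assume x: "x \<in> set r"
    then have "x \<in> set q" using lr by simp
    then have "x \<in> {1..n}" unfolding q(1) by simp
    then show "x \<in> {Suc (Suc k)..<Suc n}" using bspec[OF r x] by simp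
  next
    fix x assume x: "x \<in> {Suc (Suc k)..<Suc n}"
    then have "x \<in> set q" unfolding q(1) by simp
    moreover have "x \<notin> set l" using bspec[OF l, of x] x by auto
    ultimately show "x \<in> set r" using lr by simp
  qed
  have "l \<noteq> []" using set_l k by auto
  then have g: "free_231_2143 l" "sorted r"
    using free_231_2143_insert_top[OF _ l r] q(3) unfolding lr by blast+
  have dist: "distinct l" "distinct r" using q(2) lr by simp_all
  have "r = top_list k n"
    unfolding top_list_def by (rule sorted_eq_upt[OF g(2) dist(2) set_r])
  moreover have "l \<in> permutations_of_set {1..k}"
    by (intro permutations_of_setI set_l dist(1))
  ultimately have "q = ?f l" "l \<in> ?X" using lr g(1) by simp_all
  then show "q \<in> ?f ` ?X" by (rule image_eqI)
next
  fix q assume "q \<in> ?f ` ?X"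
  then obtain p where p: "p \<in> permutations_of_set {1..k}" "free_231_2143 p" and q: "q = p @ top_list k n"
    by blast
  note pD = permutations_of_setD[OF p(1)]
  have "p \<noteq> []" using permutation_neq_Nil[OF p(1)] k by simp
  moreover have "\<forall>x\<in>set p. x < Suc k" unfolding pD(1) by simp
  moreover have "\<forall>x\<in>set (top_list k n). Suc k < x" by simp
  ultimately have "free_231_2143 (Suc k # q)"
    unfolding q using p(2) by (simp add: free_231_2143_insert_top)
  moreover have "q \<in> permutations_of_set ({1..n} - {Suc k})"
  proof (rule permutations_of_setI)
    show "set q = {1..n} - {Suc k}"
      unfolding q set_append pD(1) top_list_simps using k by auto
    show "distinct q"
      unfolding q distinct_append pD(1) top_list_simps using pD(2) by auto
  qed
  ultimately show "q \<in> ?L" by blast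
qed

text \<open>A first entry 1 is deleted with a downward shift; a first entry \<open>Suc k\<close>
  leaves only the arrangement of the \<open>k\<close> smaller entries free.\<close>

lemma num_free_231_2143_Suc: "num_free_231_2143 (Suc m) = num_free_231_2143 m + (\<Sum>k = 1..m. num_free_231_2143 k)"
proof -
  have "card {q. q \<in> permutations_of_set ({1..Suc m} - {1}) \<and> free_231_2143 (1 # q)} =
      card {q. q \<in> permutations_of_set {Suc 1..m + 1} \<and> free_231_2143 q}"
    unfolding diff_first
    by (intro arg_cong[where f = card] Collect_cong conj_cong refl)
      (auto simp: free_231_2143_Cons_Suc0 dest!: permutations_of_setD(1))
  also have "\<dots> = num_free_231_2143 m"
    unfolding card_permutations_shift free_231_2143_map_add num_free_231_2143_def ..
  finally have 1: "card {q. q \<in> permutations_of_set ({1..Suc m} - {1}) \<and> free_231_2143 (1 # q)} = num_free_231_2143 m" .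
  have 2: "card {q. q \<in> permutations_of_set ({1..Suc m} - {Suc k}) \<and> free_231_2143 (Suc k # q)} = num_free_231_2143 k"
    if "k \<in> {1..m}" for k
    using that by (subst free_231_2143_tops_image) (auto simp: card_image inj_on_def num_free_231_2143_def)
  have "num_free_231_2143 (Suc m) =
      (\<Sum>a = 1..Suc m. card {q. q \<in> permutations_of_set ({1..Suc m} - {a}) \<and> free_231_2143 (a # q)})"
    unfolding num_free_231_2143_def by (rule card_permutations_by_first) simp_all
  then show ?thesis unfolding sum_first_Suc 1 by (simp only: 2 cong: sum.cong)
qed

lemma free_231_2143_sorted: "sorted p \<Longrightarrow> free_231_2143 p"
proof -
  assume p: "sorted p"
  have le: "a \<le> b" if "subseq [a, b] p" for a b
    using p that sorted_iff_subseq by blast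
  have "not_231 a b c" if "subseq [a, b, c] p" for a b c
    using le[of a c] subseq3_pairs[OF that] by (simp add: not_231_def)
  moreover have "not_triple_pattern a b c d" if "subseq [a, b, c, d] p" for a b c d
    using le[of a b] le[of a c] subseq4_triples[OF that] subseq3_pairs[of a b c p] by (simp add: not_triple_pattern_def)
  ultimately show "free_231_2143 p" unfolding free_231_2143_def triple_free_def by blast
qed

text \<open>Prepending 1 preserves the cuts and makes the start a new one only for the identity,
  hence the term 1. With first entry \<open>Suc k\<close> the start is never admissible, while the
  \<open>m - k\<close> larger entries at the end add as many cuts to each permutation.\<close>

lemma num_splits_Suc:
  "num_splits (Suc m) = num_splits m + 1 + (\<Sum>k = 1..m. num_splits k + (m - k) * num_free_231_2143 k)"
proof -
  let ?h = "\<lambda>a. (\<Sum>q | q \<in> permutations_of_set ({1..Suc m} - {a}) \<and> free_231_2143 (a # q). splits (a # q))"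
  have "?h 1 = (\<Sum>q | q \<in> permutations_of_set {Suc 1..m + 1} \<and> free_231_2143 q. splits (1 # q))"
    unfolding diff_first
    by (intro sum.cong Collect_cong conj_cong refl)
      (auto simp: free_231_2143_Cons_Suc0 dest!: permutations_of_setD(1))
  also have "\<dots> = (\<Sum>q | q \<in> permutations_of_set {Suc 1..m + 1} \<and> free_231_2143 q. splits q + of_bool (sorted q))"
    by (intro sum.cong refl) (auto simp: splits_Cons dest!: permutations_of_setD(1))
  also have "\<dots> = num_splits m + (\<Sum>p | p \<in> permutations_of_set {1..m} \<and> free_231_2143 p. of_bool (sorted p))"
    unfolding sum_permutations_shift num_splits_def free_231_2143_map_add splits_map_add sorted_map_add
    by (rule sum.distrib)
  also have "(\<Sum>p | p \<in> permutations_of_set {1..m} \<and> free_231_2143 p. of_bool (sorted p)) = (1 :: nat)"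
  proof -
    have "{p. p \<in> permutations_of_set {1..m} \<and> free_231_2143 p} \<inter> {p. sorted p} = {[1..<Suc m]}"
    proof (intro equalityI subsetI)
      fix p assume p: "p \<in> {p. p \<in> permutations_of_set {1..m} \<and> free_231_2143 p} \<inter> {p. sorted p}"
      then have "sorted p" "distinct p" "set p = {1..<Suc m}"
        by (auto dest: permutations_of_setD simp: atLeastLessThanSuc_atLeastAtMost)
      then show "p \<in> {[1..<Suc m]}" using sorted_eq_upt by blast
    next
      fix p assume "p \<in> {[1..<Suc m]}"
      then have "p = [1..<Suc m]" by simp
      then show "p \<in> {p. p \<in> permutations_of_set {1..m} \<and> free_231_2143 p} \<inter> {p. sorted p}"
        using free_231_2143_sorted[of p] by (auto simp: atLeastLessThanSuc_atLeastAtMost simp del: upt_Suc)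
    qed
    then show ?thesis by (subst sum_of_bool_eq) simp_all
  qed
  finally have 1: "?h 1 = num_splits m + 1" .
  have 2: "?h (Suc k) = num_splits k + (m - k) * num_free_231_2143 k" if k: "k \<in> {1..m}" for k
  proof -
    have "splits (Suc k # p @ top_list k (Suc m)) = splits p + (m - k)"
      if p: "p \<in> permutations_of_set {1..k}" for p
    proof -
      have ne: "p \<noteq> []" using permutation_neq_Nil[OF p] k by simp
      have set: "\<forall>x\<in>set p. x < Suc k" using permutations_of_setD(1)[OF p] by auto
      have "\<not> sorted (Suc k # p @ top_list k (Suc m))"
        using ne set by (cases p) auto
      moreover have "splits (p @ top_list k (Suc m)) = splits p + (m - k)"
        using set by (subst splits_append_top) auto
      ultimately show ?thesis by (simp add: splits_Cons del: sorted_simps)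
    qed
    then have "(\<Sum>p | p \<in> permutations_of_set {1..k} \<and> free_231_2143 p. splits (Suc k # p @ top_list k (Suc m))) =
        (\<Sum>p | p \<in> permutations_of_set {1..k} \<and> free_231_2143 p. splits p + (m - k))"
      by (intro sum.cong) auto
    also have "\<dots> = num_splits k + (m - k) * num_free_231_2143 k"
      by (simp add: sum.distrib num_splits_def num_free_231_2143_def)
    finally show ?thesis
      using k by (subst free_231_2143_tops_image) (auto simp: sum.reindex inj_on_def)
  qed
  have "num_splits (Suc m) = (\<Sum>a = 1..Suc m. ?h a)"
    unfolding num_splits_def by (rule sum_permutations_by_first) simp_all
  then show ?thesis unfolding sum_first_Suc 1 by (simp only: 2 cong: sum.cong)
qed

section \<open>The first entry 2, and the class \<open>triple_free_last\<close>\<close>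

lemma insert_at_in_permutations:
  assumes "r \<in> permutations_of_set A" "s \<notin> A"
  shows "take j r @ s # drop j r \<in> permutations_of_set (insert s A)"
proof (rule permutations_of_setI)
  note r = permutations_of_setD[OF assms(1)]
  show "set (take j r @ s # drop j r) = insert s A"
    unfolding r(1)[symmetric] using set_take_drop[of j r] by (simp only: set_append set_simps) blast
  have "s \<notin> set (take j r)" "s \<notin> set (drop j r)"
    using r(1) assms(2) by (auto dest: in_set_takeD in_set_dropD)
  moreover have "distinct (take j r @ drop j r)" using r(2) by simp
  ultimately show "distinct (take j r @ s # drop j r)"
    unfolding distinct_append distinct.simps set_simps by blast
qed

lemma first_two_set: "{1..m + 2} - {2} = insert 1 {Suc 2..m + 2}"
  by auto

text \<open>The word \<open>r\<close> consists of the entries from 3 on, and \<open>j\<close> is the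
  position of the entry 1, which \<open>triple_free_two_one\<close> restricts to admissible cuts of
  \<open>r\<close>.\<close>

lemma first_two_image:
  "{q. q \<in> permutations_of_set ({1..m + 2} - {2}) \<and> triple_free (2 # q)} =
    (\<lambda>(r, j). take j r @ 1 # drop j r) `
      (SIGMA r : {r. r \<in> permutations_of_set {Suc 2..m + 2} \<and> free_231_2143 r}.
        {j. j \<le> length r \<and> sorted (drop j r)})" (is "?L = ?f ` ?X")
proof (intro equalityI subsetI)
  fix q assume "q \<in> ?L"
  then have q: "set q = insert 1 {Suc 2..m + 2}" "distinct q" "triple_free (2 # q)"
    unfolding first_two_set by (auto dest: permutations_of_setD)
  have "1 \<in> set q" by (simp add: q(1))
  then obtain ys zs where yz: "q = ys @ 1 # zs" by (meson split_list)
  have dist: "distinct (ys @ zs)" and notin: "1 \<notin> set (ys @ zs)"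
    using q(2) yz by auto
  have "set (ys @ zs) = set q - {1}" using notin yz by auto
  then have set: "set (ys @ zs) = {Suc 2..m + 2}" unfolding q(1) by auto
  have gt: "\<forall>x\<in>set (ys @ zs). 2 < x" unfolding set by simp
  have "free_231_2143 (ys @ zs) \<and> sorted zs"
    using q(3) triple_free_two_one[OF gt] unfolding yz by blast
  moreover have "ys @ zs \<in> permutations_of_set {Suc 2..m + 2}"
    by (intro permutations_of_setI set dist)
  ultimately have "(ys @ zs, length ys) \<in> ?X" by simp
  moreover have "q = ?f (ys @ zs, length ys)" using yz by simp
  ultimately show "q \<in> ?f ` ?X" by (rule image_eqI[rotated])
next
  fix q assume "q \<in> ?f ` ?X"
  then obtain u where u: "u \<in> ?X" "q = ?f u" by (rule imageE)
  obtain r j where "u = (r, j)" by (cases u)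
  then have r: "r \<in> permutations_of_set {Suc 2..m + 2}" "free_231_2143 r" "sorted (drop j r)"
    and q: "q = take j r @ 1 # drop j r"
    using u by simp_all
  have "\<forall>x\<in>set (take j r @ drop j r). 2 < x"
    using permutations_of_setD(1)[OF r(1)] by simp
  then have "triple_free (2 # q)"
    using triple_free_two_one[of "take j r" "drop j r"] r(2,3) unfolding q append_take_drop_id by blast
  moreover have "q \<in> permutations_of_set ({1..m + 2} - {2})"
    unfolding q first_two_set by (rule insert_at_in_permutations[OF r(1)]) simp
  ultimately show "q \<in> ?L" by blast
qed

lemma first_two_inj:
  "inj_on (\<lambda>(r, j). take j r @ (1 :: nat) # drop j r)
    (SIGMA r : {r. r \<in> permutations_of_set {Suc 2..m + 2} \<and> free_231_2143 r}.
        {j. j \<le> length r \<and> sorted (drop j r)})" (is "inj_on ?f ?X")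
proof (rule inj_onI)
  have flt: "filter (\<lambda>x. x \<noteq> 1) (?f (r, j)) = r \<and> 1 \<notin> set r \<and> j \<le> length r" if "(r, j) \<in> ?X" for r j
  proof -
    have "set r = {Suc 2..m + 2}" using that permutations_of_setD(1) by blast
    then have notin: "1 \<notin> set r" by simp
    have "filter (\<lambda>x. x \<noteq> 1) (?f (r, j)) = filter (\<lambda>x. x \<noteq> 1) (take j r @ drop j r)"
      by (simp only: filter_append case_prod_conv filter.simps refl not_True_eq_False if_False)
    also have "\<dots> = r"
      unfolding append_take_drop_id using notin by (intro filter_True) blast
    finally show ?thesis using notin that by simp
  qed
  fix u v assume uv: "u \<in> ?X" "v \<in> ?X" and eq: "?f u = ?f v"
  obtain r i where u: "u = (r, i)" by (cases u)
  obtain r' j where v: "v = (r', j)" by (cases v)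
  note fu = flt[OF uv(1)[unfolded u]] and fv = flt[OF uv(2)[unfolded v]]
  have "r = filter (\<lambda>x. x \<noteq> 1) (?f u)" unfolding u by (rule fu[THEN conjunct1, symmetric])
  also have "\<dots> = r'" unfolding eq v by (rule fv[THEN conjunct1])
  finally have rr: "r = r'" .
  have "i = j"
    using inj_insert_at[of i r 1 j] eq fu fv unfolding u v rr case_prod_conv by blast
  then show "u = v" by (simp add: u v rr)
qed

text \<open>If an entry follows the 1, the last entry exceeds 2 and the descent 2, 1 lies below it.
  If the 1 is last, no entry is smaller.\<close>

lemma triple_free_last_first_two:
  assumes "r \<in> permutations_of_set {Suc 2..m + 2}" "j \<le> length r"
    "triple_free (2 # take j r @ 1 # drop j r)"
  shows "triple_free_last (2 # take j r @ 1 # drop j r) \<longleftrightarrow> j = length r"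
proof
  have set: "set r = {Suc 2..m + 2}" by (rule permutations_of_setD(1)[OF assms(1)])
  assume g: "triple_free_last (2 # take j r @ 1 # drop j r)"
  show "j = length r"
  proof (rule ccontr)
    assume "j \<noteq> length r"
    then have ne: "drop j r \<noteq> []" using assms(2) by simp
    define l where "l = last (drop j r)"
    have "l \<in> set r" unfolding l_def by (rule in_set_dropD[OF last_in_set[OF ne]])
    then have l: "2 < l" using set by simp
    have "last (2 # take j r @ 1 # drop j r) = l" using ne by (simp add: l_def)
    then have "sorted (filter (\<lambda>x. x < l) (2 # take j r @ 1 # drop j r))"
      using g unfolding triple_free_last_def by simp
    then have "sorted (2 # filter (\<lambda>x. x < l) (take j r) @ 1 # filter (\<lambda>x. x < l) (drop j r))"
      using l by simp
    then show False by simp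
  qed
next
  have set: "set r = {Suc 2..m + 2}" by (rule permutations_of_setD(1)[OF assms(1)])
  assume j: "j = length r"
  have "filter (\<lambda>x. x < 1) (2 # r @ [1]) = []"
    using set by (simp add: filter_empty_conv)
  then have "sorted (filter (\<lambda>x. x < 1) (2 # r @ [1]))" by simp
  then show "triple_free_last (2 # take j r @ 1 # drop j r)"
    using assms(3) j unfolding triple_free_last_def by simp
qed

text \<open>If a larger entry remains behind the last entry of \<open>p\<close>, the word ends in a
  larger entry, which lies above the descent from \<open>Suc k\<close> to the first entry of
  \<open>p\<close>. Otherwise the last entry of \<open>p\<close> stays last, and the entries below
  it are unchanged.\<close>

lemma triple_free_last_insert_tops:
  assumes p: "p \<in> permutations_of_set {1..k}" and k: "2 \<le> k" and j: "j \<le> n - Suc k"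
  shows "triple_free_last (Suc k # insert_tops k n (p, j)) \<longleftrightarrow> triple_free_last p \<and> j = n - Suc k"
proof -
  let ?B = "top_list k n"
  have ne: "p \<noteq> []" using permutation_neq_Nil[OF p] k by simp
  obtain xs s where xs: "p = xs @ [s]" using ne by (cases p rule: rev_cases) auto
  have "length p = k"
    using permutations_of_setD[OF p] by (metis card_atLeastAtMost diff_Suc_1 distinct_card)
  then obtain c cs where c: "xs = c # cs" using k xs by (cases xs) auto
  have "set xs \<subseteq> {1..k}" "s \<in> {1..k}" using permutations_of_setD(1)[OF p] xs by auto
  then have small: "\<forall>x\<in>set xs. x < Suc k" "s < Suc k" by auto
  have eq: "insert_tops k n (p, j) = xs @ take j ?B @ s # drop j ?B"
    by (simp add: insert_tops_def xs)
  note g = insert_tops_triple_free(1)[OF p ne j]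
  have g3: "triple_free_last p \<longleftrightarrow> triple_free p \<and> sorted (filter (\<lambda>x. x < s) xs)"
    by (simp add: triple_free_last_def xs)
  show ?thesis
  proof (cases "j = n - Suc k")
    case True
    have e: "Suc k # insert_tops k n (p, j) = Suc k # xs @ ?B @ [s]"
      unfolding eq by (simp add: True)
    have "\<forall>x\<in>set ?B. \<not> x < s" using small(2) by auto
    then have "filter (\<lambda>x. x < s) ?B = []" by (simp only: filter_empty_conv)
    then have f: "filter (\<lambda>x. x < s) (Suc k # xs @ ?B @ [s]) = filter (\<lambda>x. x < s) xs"
      using small(2) by simp
    have "last (Suc k # xs @ ?B @ [s]) = s" by simp
    then have "triple_free_last (Suc k # insert_tops k n (p, j)) \<longleftrightarrow>
        triple_free (Suc k # insert_tops k n (p, j)) \<and> sorted (filter (\<lambda>x. x < s) xs)"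
      unfolding triple_free_last_def e by (simp only: f)
    then show ?thesis unfolding g using g3 True by blast
  next
    case False
    then have ne: "drop j ?B \<noteq> []" using j by simp
    define l where "l = last (drop j ?B)"
    have "l \<in> set ?B" unfolding l_def by (rule in_set_dropD[OF last_in_set[OF ne]])
    then have l: "Suc k < l" by simp
    have "c < Suc k" using small c by simp
    moreover have "last (Suc k # insert_tops k n (p, j)) = l"
      unfolding eq using ne by (simp add: l_def)
    ultimately have "\<not> triple_free_last (Suc k # insert_tops k n (p, j))"
      unfolding triple_free_last_def using l by (simp add: eq c)
    then show ?thesis using False by blast
  qed
qed

lemma triple_free_last_imp_triple_free: "triple_free_last p \<Longrightarrow> triple_free p"
  by (simp add: triple_free_last_def)

lemma card_triple_free_insert_tops:
  assumes k: "2 \<le> k" "k < n"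
  shows "card {q. q \<in> permutations_of_set ({1..n} - {Suc k}) \<and> triple_free (Suc k # q)} =
    num_triple_free k + (n - Suc k) * num_triple_free_last k"
proof -
  let ?X = "{(p, j). p \<in> permutations_of_set {1..k} \<and> j \<le> n - Suc k \<and> triple_free p \<and> (j = 0 \<or> triple_free_last p)}"
  let ?G = "{p. p \<in> permutations_of_set {1..k} \<and> triple_free p}"
  let ?H = "{p. p \<in> permutations_of_set {1..k} \<and> triple_free_last p}"
  \<comment> \<open>The cut 0 is open to every \<open>p\<close>, the \<open>n - Suc k\<close>
    positive cuts only to those in the smaller class.\<close>
  have X: "?X = ?G \<times> {0} \<union> ?H \<times> {1..n - Suc k}"
    by (auto dest: triple_free_last_imp_triple_free simp: Suc_le_eq)
  have "inj_on (insert_tops k n) ?X"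
    by (rule inj_on_subset[OF insert_tops_inj]) (use k in auto)
  then have "card {q. q \<in> permutations_of_set ({1..n} - {Suc k}) \<and> triple_free (Suc k # q)} = card ?X"
    unfolding insert_tops_image[OF k] by (rule card_image)
  also have "\<dots> = card (?G \<times> {0 :: nat}) + card (?H \<times> {1..n - Suc k})"
    unfolding X by (rule card_Un_disjoint) auto
  also have "\<dots> = num_triple_free k + (n - Suc k) * num_triple_free_last k"
    unfolding card_cartesian_product num_triple_free_def num_triple_free_last_def by simp
  finally show ?thesis .
qed

lemma card_triple_free_last_insert_tops:
  assumes k: "2 \<le> k" "k < n"
  shows "card {q. q \<in> permutations_of_set ({1..n} - {Suc k}) \<and> triple_free_last (Suc k # q)} = num_triple_free_last k"
proof -
  let ?X = "{(p, j). p \<in> permutations_of_set {1..k} \<and> j \<le> n - Suc k \<and> triple_free p \<and> (j = 0 \<or> triple_free_last p)}"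
  let ?H = "{p. p \<in> permutations_of_set {1..k} \<and> triple_free_last p}"
  have "{q. q \<in> permutations_of_set ({1..n} - {Suc k}) \<and> triple_free_last (Suc k # q)} =
      {q \<in> insert_tops k n ` ?X. triple_free_last (Suc k # q)}"
    unfolding insert_tops_image[OF k, symmetric] by (auto dest: triple_free_last_imp_triple_free)
  also have "\<dots> = insert_tops k n ` {u \<in> ?X. triple_free_last (Suc k # insert_tops k n u)}"
    by blast
  \<comment> \<open>The cut is forced to be the last one, so each \<open>p\<close> counts
    once.\<close>
  also have "{u \<in> ?X. triple_free_last (Suc k # insert_tops k n u)} = ?H \<times> {n - Suc k}"
    using triple_free_last_insert_tops[OF _ k(1)] by (auto dest: triple_free_last_imp_triple_free)
  also have "card (insert_tops k n ` (?H \<times> {n - Suc k})) = card (?H \<times> {n - Suc k})"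
    by (rule card_image, rule inj_on_subset[OF insert_tops_inj]) (use k in auto)
  finally show ?thesis by (simp add: num_triple_free_last_def)
qed

lemma card_triple_free_first_two:
  "card {q. q \<in> permutations_of_set ({1..m + 2} - {2}) \<and> triple_free (2 # q)} = num_splits m"
proof -
  let ?R = "{r. r \<in> permutations_of_set {Suc 2..m + 2} \<and> free_231_2143 r}"
  have "card (SIGMA r : ?R. {j. j \<le> length r \<and> sorted (drop j r)}) =
      (\<Sum>r\<in>?R. card {j. j \<le> length r \<and> sorted (drop j r)})"
    by (rule card_SigmaI) simp_all
  also have "\<dots> = num_splits m"
    unfolding splits_def[symmetric] sum_permutations_shift free_231_2143_map_add splits_map_add num_splits_def ..
  finally show ?thesis unfolding first_two_image card_image[OF first_two_inj] .
qed

text \<open>Only the cut at the end survives, so the remaining word is counted without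
  weight.\<close>

lemma card_triple_free_last_first_two:
  "card {q. q \<in> permutations_of_set ({1..m + 2} - {2}) \<and> triple_free_last (2 # q)} = num_free_231_2143 m"
proof -
  let ?f = "\<lambda>(r, j). take j r @ (1 :: nat) # drop j r"
  let ?R = "{r. r \<in> permutations_of_set {Suc 2..m + 2} \<and> free_231_2143 r}"
  let ?X = "SIGMA r : ?R. {j. j \<le> length r \<and> sorted (drop j r)}"
  let ?g = "\<lambda>r. (r, length r) :: nat list \<times> nat"
  have triple_free: "triple_free (2 # ?f u)" if "u \<in> ?X" for u
    using imageI[OF that, of ?f] unfolding first_two_image[symmetric] by blast
  have "{q. q \<in> permutations_of_set ({1..m + 2} - {2}) \<and> triple_free_last (2 # q)} =
      {q \<in> ?f ` ?X. triple_free_last (2 # q)}"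
    unfolding first_two_image[symmetric] by (auto dest: triple_free_last_imp_triple_free)
  also have "\<dots> = ?f ` {u \<in> ?X. triple_free_last (2 # ?f u)}"
    by blast
  also have "{u \<in> ?X. triple_free_last (2 # ?f u)} = ?g ` ?R"
  proof (intro equalityI subsetI)
    fix u assume u: "u \<in> {u \<in> ?X. triple_free_last (2 # ?f u)}"
    obtain r j where rj: "u = (r, j)" by (cases u)
    then have "r \<in> ?R" "j \<le> length r" "triple_free_last (2 # take j r @ 1 # drop j r)" using u by simp_all
    moreover from this have "j = length r" using triple_free_last_first_two triple_free_last_imp_triple_free by blast
    ultimately show "u \<in> ?g ` ?R" unfolding rj by blast
  next
    fix u assume "u \<in> ?g ` ?R"
    then obtain r where r: "r \<in> ?R" "u = (r, length r)" by (rule imageE)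
    then have u: "u \<in> ?X" by simp
    moreover have "triple_free_last (2 # ?f u)"
      using triple_free_last_first_two[of r m "length r"] triple_free[OF u] r by simp
    ultimately show "u \<in> {u \<in> ?X. triple_free_last (2 # ?f u)}" by blast
  qed
  also have "card (?f ` ?g ` ?R) = card ?R"
  proof -
    have "inj_on ?f (?g ` ?R)" by (rule inj_on_subset[OF first_two_inj[of m]]) auto
    moreover have "inj_on ?g ?R" by (rule inj_onI) simp
    ultimately show ?thesis by (simp only: card_image)
  qed
  also have "\<dots> = num_free_231_2143 m"
    unfolding card_permutations_shift free_231_2143_map_add num_free_231_2143_def ..
  finally show ?thesis .
qed

section \<open>Recurrences for the avoiders and for the class
  \<open>triple_free_last\<close>\<close>

lemma sum_first_two_Suc:
  "(\<Sum>a = 1..m + 2. f a) = f 1 + f 2 + (\<Sum>k = 2..Suc m. f (Suc k) :: nat)"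
  by (induction m) (simp_all add: numeral_2_eq_2)

lemma triple_free_last_Cons_Suc0:
  assumes "q \<in> permutations_of_set {Suc 1..Suc m + 1}"
  shows "triple_free_last (1 # q) \<longleftrightarrow> triple_free_last q"
proof -
  have ne: "q \<noteq> []" using permutation_neq_Nil[OF assms] by simp
  have set: "set q = {Suc 1..Suc m + 1}" by (rule permutations_of_setD(1)[OF assms])
  then have gt: "\<forall>x\<in>set q. 1 < x" by simp
  then have "1 < last q" using last_in_set[OF ne] by blast
  then have "sorted (filter (\<lambda>x. x < last q) (1 # q)) \<longleftrightarrow> sorted (filter (\<lambda>x. x < last q) q)"
    using gt by (simp add: less_imp_le)
  moreover have "triple_free (1 # q) \<longleftrightarrow> triple_free q"
    using triple_free_Cons_Suc0[of q] gt by (simp add: Suc_lessD)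
  ultimately show ?thesis using ne by (simp add: triple_free_last_def)
qed

text \<open>The contributions come from first entry 1, first entry 2, and first entry
  \<open>Suc k\<close> with \<open>2 \<le> k\<close>, where the cut is forced.\<close>

lemma num_triple_free_last_Suc:
  "num_triple_free_last (Suc (Suc m)) = num_triple_free_last (Suc m) + num_free_231_2143 m + (\<Sum>k = 2..Suc m. num_triple_free_last k)"
proof -
  let ?h = "\<lambda>a. card {q. q \<in> permutations_of_set ({1..m + 2} - {a}) \<and> triple_free_last (a # q)}"
  have "?h 1 = card {q. q \<in> permutations_of_set {Suc 1..Suc m + 1} \<and> triple_free_last (1 # q)}"
    using diff_first[of "Suc m"] by simp
  also have "\<dots> = card {q. q \<in> permutations_of_set {Suc 1..Suc m + 1} \<and> triple_free_last q}"
    by (intro arg_cong[where f = card] Collect_cong conj_cong refl triple_free_last_Cons_Suc0)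
  also have "\<dots> = card {p. p \<in> permutations_of_set {1..Suc m} \<and> triple_free_last (map (\<lambda>x. x + 1) p)}"
    by (rule card_permutations_shift)
  also have "\<dots> = num_triple_free_last (Suc m)"
    unfolding num_triple_free_last_def
    by (intro arg_cong[where f = card] Collect_cong conj_cong refl triple_free_last_map_add)
      (rule permutation_neq_Nil, assumption, simp)
  finally have 1: "?h 1 = num_triple_free_last (Suc m)" .
  have 2: "?h (Suc k) = num_triple_free_last k" if "k \<in> {2..Suc m}" for k
    by (rule card_triple_free_last_insert_tops) (use that in auto)
  have "num_triple_free_last (m + 2) = (\<Sum>a = 1..m + 2. ?h a)"
    unfolding num_triple_free_last_def by (rule card_permutations_by_first) simp_all
  also have "\<dots> = num_triple_free_last (Suc m) + num_free_231_2143 m + (\<Sum>k = 2..Suc m. ?h (Suc k))"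
    unfolding sum_first_two_Suc 1 card_triple_free_last_first_two ..
  also have "(\<Sum>k = 2..Suc m. ?h (Suc k)) = (\<Sum>k = 2..Suc m. num_triple_free_last k)"
    by (rule sum.cong[OF refl 2])
  finally show ?thesis by simp
qed

text \<open>A first entry 1 can be deleted, a first entry 2 leaves a permutation with a cut, and a
  larger first entry \<open>Suc k\<close> allows \<open>Suc m - k\<close> positive cuts for the
  permutations in \<open>triple_free_last\<close>.\<close>

lemma num_triple_free_Suc:
  "num_triple_free (Suc (Suc m)) =
    num_triple_free (Suc m) + num_splits m + (\<Sum>k = 2..Suc m. num_triple_free k + (Suc m - k) * num_triple_free_last k)"
proof -
  let ?h = "\<lambda>a. card {q. q \<in> permutations_of_set ({1..m + 2} - {a}) \<and> triple_free (a # q)}"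
  have "?h 1 = card {q. q \<in> permutations_of_set {Suc 1..Suc m + 1} \<and> triple_free (1 # q)}"
    using diff_first[of "Suc m"] by simp
  also have "\<dots> = card {q. q \<in> permutations_of_set {Suc 1..Suc m + 1} \<and> triple_free q}"
  proof (intro arg_cong[where f = card] Collect_cong conj_cong refl)
    fix q assume q: "q \<in> permutations_of_set {Suc 1..Suc m + 1}"
    have "\<forall>x\<in>set q. 0 < x" unfolding permutations_of_setD(1)[OF q] by simp
    then show "triple_free (1 # q) \<longleftrightarrow> triple_free q" using triple_free_Cons_Suc0 by simp
  qed
  also have "\<dots> = num_triple_free (Suc m)"
    unfolding card_permutations_shift triple_free_map_add num_triple_free_def ..
  finally have 1: "?h 1 = num_triple_free (Suc m)" .
  have 2: "?h (Suc k) = num_triple_free k + (Suc m - k) * num_triple_free_last k" if "k \<in> {2..Suc m}" for k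
    using card_triple_free_insert_tops[of k "m + 2"] that by simp
  have "num_triple_free (m + 2) = (\<Sum>a = 1..m + 2. ?h a)"
    unfolding num_triple_free_def by (rule card_permutations_by_first) simp_all
  also have "\<dots> = num_triple_free (Suc m) + num_splits m + (\<Sum>k = 2..Suc m. ?h (Suc k))"
    unfolding sum_first_two_Suc 1 card_triple_free_first_two ..
  also have "(\<Sum>k = 2..Suc m. ?h (Suc k)) = (\<Sum>k = 2..Suc m. num_triple_free k + (Suc m - k) * num_triple_free_last k)"
    by (rule sum.cong[OF refl 2])
  finally show ?thesis by simp
qed

section \<open>Generating functions\<close>

lemma triple_free_small [simp]: "triple_free []" "triple_free [x]" "free_231_2143 []" "triple_free_last [x]"
proof -
  have [simp]: "triple_free []" by (simp add: triple_free_def)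
  show "triple_free []" by simp
  show g: "triple_free [x]" by (simp add: triple_free_Cons)
  show "free_231_2143 []" by (simp add: free_231_2143_def)
  show "triple_free_last [x]" by (simp add: triple_free_last_def g)
qed

section \<open>Initial values and linear recurrences with constant coefficients\<close>

lemma initial_values:
  "num_triple_free 0 = 1" "num_triple_free 1 = 1" "num_free_231_2143 0 = 1" "num_triple_free_last 1 = 1" "num_splits 0 = 1"
proof -
  have 0: "{p. p \<in> permutations_of_set {1..0 :: nat} \<and> Q p} = {[]}" if "Q []" for Q
    using that by auto
  have 1: "{p. p \<in> permutations_of_set {1..1 :: nat} \<and> Q p} = {[1]}" if "Q [1]" for Q
    using that by auto
  show "num_triple_free 0 = 1" "num_free_231_2143 0 = 1"
    unfolding num_triple_free_def num_free_231_2143_def by (subst 0; simp)+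
  show "num_triple_free 1 = 1" "num_triple_free_last 1 = 1"
    unfolding num_triple_free_def num_triple_free_last_def by (subst 1; simp)+
  show "num_splits 0 = 1"
    unfolding num_splits_def by (subst 0; simp)
qed

text \<open>Subtracting two consecutive instances of the recurrence with the full sum removes the
  sum. The additive form avoids truncated subtraction on natural numbers.\<close>

lemma num_free_231_2143_rec: "num_free_231_2143 (m + 2) + num_free_231_2143 m = 3 * num_free_231_2143 (m + 1)"
  using num_free_231_2143_Suc[of "Suc m"] num_free_231_2143_Suc[of m] by simp

lemma num_splits_rec: "num_splits (m + 2) + num_splits m + num_free_231_2143 m = 3 * num_splits (m + 1) + num_free_231_2143 (m + 1)"
proof -
  have "(\<Sum>k = 1..Suc m. num_splits k + (Suc m - k) * num_free_231_2143 k) =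
      num_splits (Suc m) + (\<Sum>k = 1..m. num_splits k + (Suc m - k) * num_free_231_2143 k)"
    by simp
  \<comment> \<open>Raising the weight by one adds a copy of each count; the sum of these copies is
    known from \<open>num_free_231_2143_Suc\<close>.\<close>
  also have "(\<Sum>k = 1..m. num_splits k + (Suc m - k) * num_free_231_2143 k) =
      (\<Sum>k = 1..m. (num_splits k + (m - k) * num_free_231_2143 k) + num_free_231_2143 k)"
    by (rule sum.cong[OF refl]) (auto simp: Suc_diff_le)
  also have "\<dots> = (\<Sum>k = 1..m. num_splits k + (m - k) * num_free_231_2143 k) + (\<Sum>k = 1..m. num_free_231_2143 k)"
    by (rule sum.distrib)
  finally show ?thesis
    using num_splits_Suc[of "Suc m"] num_splits_Suc[of m] num_free_231_2143_Suc[of m] by simp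
qed

lemma num_triple_free_last_rec:
  "num_triple_free_last (m + 3) + num_triple_free_last (m + 1) + num_free_231_2143 m = 3 * num_triple_free_last (m + 2) + num_free_231_2143 (m + 1)"
  using num_triple_free_last_Suc[of "Suc m"] num_triple_free_last_Suc[of m] by (simp add: numeral_3_eq_3)

text \<open>Both sequences obey the same recurrence with the same inhomogeneous term and start with
  1, 2. This leaves three unknown sequences.\<close>

lemma num_triple_free_last_eq_num_splits: "num_triple_free_last (Suc m) = num_splits m"
proof (induction m rule: less_induct)
  case (less m)
  have "m = 0 \<or> m = 1 \<or> (\<exists>k. m = k + 2)" by presburger
  then consider "m = 0" | "m = 1" | k where "m = k + 2" by blast
  then show ?case
  proof cases
    case 1
    then show ?thesis using initial_values by simp
  next
    case 2
    then show ?thesis using initial_values num_triple_free_last_Suc[of 0] num_splits_Suc[of 0] by simp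
  next
    case 3
    then show ?thesis
      using less.IH[of k] less.IH[of "k + 1"] num_triple_free_last_rec[of k] num_splits_rec[of k]
      by (simp add: numeral_3_eq_3)
  qed
qed

text \<open>In the difference of consecutive instances the weights leave a sum of
  \<open>num_triple_free_last\<close>, which \<open>num_triple_free_last_Suc\<close> evaluates; its
  values are then replaced by those of \<open>num_splits\<close>.\<close>

lemma num_triple_free_rec:
  "num_triple_free (m + 3) + num_triple_free (m + 1) + 2 * num_splits m + num_free_231_2143 m =
    3 * num_triple_free (m + 2) + 2 * num_splits (m + 1)"
proof -
  have "(\<Sum>k = 2..Suc (Suc m). num_triple_free k + (Suc (Suc m) - k) * num_triple_free_last k) =
      num_triple_free (Suc (Suc m)) + (\<Sum>k = 2..Suc m. num_triple_free k + (Suc (Suc m) - k) * num_triple_free_last k)"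
    by simp
  also have "(\<Sum>k = 2..Suc m. num_triple_free k + (Suc (Suc m) - k) * num_triple_free_last k) =
      (\<Sum>k = 2..Suc m. (num_triple_free k + (Suc m - k) * num_triple_free_last k) + num_triple_free_last k)"
    by (rule sum.cong[OF refl]) (auto simp: Suc_diff_le)
  also have "\<dots> = (\<Sum>k = 2..Suc m. num_triple_free k + (Suc m - k) * num_triple_free_last k) + (\<Sum>k = 2..Suc m. num_triple_free_last k)"
    by (rule sum.distrib)
  finally have "num_triple_free (m + 3) + num_triple_free (m + 1) + num_splits m + num_triple_free_last (m + 1) + num_free_231_2143 m =
    3 * num_triple_free (m + 2) + num_splits (m + 1) + num_triple_free_last (m + 2)"
    using num_triple_free_Suc[of "Suc m"] num_triple_free_Suc[of m] num_triple_free_last_Suc[of m] by (simp add: numeral_3_eq_3)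
  then show ?thesis
    using num_triple_free_last_eq_num_splits[of m] num_triple_free_last_eq_num_splits[of "Suc m"] by simp
qed

section \<open>From recurrences to rational power series\<close>

lemma fps_recurrence:
  fixes a c :: "nat \<Rightarrow> rat"
  assumes "\<And>n. a (n + 2) = 3 * a (n + 1) - a n + c n"
  shows "(1 - 3 * fps_X + fps_X ^ 2) * Abs_fps a =
    fps_const (a 0) + fps_const (a 1 - 3 * a 0) * fps_X + fps_X ^ 2 * Abs_fps c" (is "?l = ?r")
proof (rule fps_ext)
  fix n :: nat
  have l: "?l = Abs_fps a - fps_const 3 * (fps_X * Abs_fps a) + fps_X ^ 2 * Abs_fps a"
    by (simp add: numeral_fps_const algebra_simps)
  \<comment> \<open>Degrees 0 and 1 carry the initial values; from degree 2 on the coefficient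
    identity is the recurrence.\<close>
  have "n = 0 \<or> n = 1 \<or> (\<exists>k. n = k + 2)" by presburger
  then consider "n = 0" | "n = 1" | k where "n = k + 2" by blast
  then show "fps_nth ?l n = fps_nth ?r n"
    unfolding l by cases (simp_all add: assms[simplified] fps_X_power_mult_nth)
qed

text \<open>Handles inhomogeneous terms that are consecutive differences: the factor
  \<open>fps_X\<close> undoes the index shift at the cost of the initial value.\<close>

lemma fps_X_mult_difference:
  fixes a :: "nat \<Rightarrow> rat"
  shows "fps_X * Abs_fps (\<lambda>n. a (n + 1) - a n) = (1 - fps_X) * Abs_fps a - fps_const (a 0)"
  by (rule fps_ext) (simp add: algebra_simps)

theorem theorem3p47:
  fixes T :: "nat list set"
  assumes "T = {[3,4,1,2], [3,4,2,1], [2,1,4,3]}"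
  shows "avoiders_gf T =
    (1 - 8 * fps_X + 23 * fps_X ^ 2 - 27 * fps_X ^ 3 + 12 * fps_X ^ 4 - 5 * fps_X ^ 5)
      / (1 - 3 * fps_X + fps_X ^ 2) ^ 3"
proof -
  define D :: "rat fps" where "D = 1 - 3 * fps_X + fps_X ^ 2"
  define s f v :: "nat \<Rightarrow> rat" where
    "s n = of_nat (num_triple_free n)" and "f n = of_nat (num_free_231_2143 n)" and "v n = of_nat (num_splits n)" for n
  define S F V where "S = Abs_fps s" and "F = Abs_fps f" and "V = Abs_fps v"
  have init: "s 0 = 1" "s 1 = 1" "s 2 = 2" "f 0 = 1" "f 1 = 1" "v 0 = 1" "v 1 = 2"
    using initial_values num_triple_free_Suc[of 0] num_free_231_2143_Suc[of 0] num_splits_Suc[of 0]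
    by (simp_all add: s_def f_def v_def numeral_2_eq_2)
  have const: "fps_const (f 0) = 1" "fps_const (f 1 - 3 * f 0) = - 2" "fps_const (v 0) = 1"
    "fps_const (v 1 - 3 * v 0) = - 1" "fps_const (s 0) = 1" "fps_const (s 1 - 3 * s 0) = - 2"
    unfolding init by (simp_all add: numeral_fps_const fps_const_neg[symmetric] del: fps_const_neg)
  \<comment> \<open>The \<open>+ 0\<close> is a zero inhomogeneous term, which gives the shape of
    \<open>fps_recurrence\<close>.\<close>
  have rec_f: "f (n + 2) = 3 * f (n + 1) - f n + 0" for n
    using arg_cong[OF num_free_231_2143_rec[of n], of "of_nat :: nat \<Rightarrow> rat"] by (simp add: f_def)
  have rec_v: "v (n + 2) = 3 * v (n + 1) - v n + (f (n + 1) - f n)" for n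
    using arg_cong[OF num_splits_rec[of n], of "of_nat :: nat \<Rightarrow> rat"] by (simp add: f_def v_def)
  \<comment> \<open>\<open>num_triple_free_rec\<close> relates sizes from 1 on, so its inhomogeneous
    term is shifted by one place. The value 0 at index 0 fits
    \<open>s 2 = 3 * s 1 - s 0\<close>.\<close>
  define c where "c n = (case n of 0 \<Rightarrow> 0 | Suc m \<Rightarrow> 2 * (v (m + 1) - v m) - f m)" for n
  have rec_s: "s (n + 2) = 3 * s (n + 1) - s n + c n" for n
  proof (cases n)
    case 0
    then show ?thesis using init by (simp add: c_def numeral_2_eq_2)
  next
    case (Suc m)
    then show ?thesis
      using arg_cong[OF num_triple_free_rec[of m], of "of_nat :: nat \<Rightarrow> rat"]
      by (simp add: f_def v_def s_def c_def numeral_3_eq_3 numeral_2_eq_2)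
  qed
  have "D * F = fps_const (f 0) + fps_const (f 1 - 3 * f 0) * fps_X + fps_X ^ 2 * Abs_fps (\<lambda>_. 0)"
    unfolding D_def F_def by (rule fps_recurrence) (rule rec_f)
  moreover have "Abs_fps (\<lambda>_. 0 :: rat) = 0" by (rule fps_ext) simp
  ultimately have F: "D * F = 1 - 2 * fps_X"
    unfolding const by simp
  \<comment> \<open>One factor of \<open>fps_X ^ 2\<close> is set aside for the difference, as
    \<open>fps_X_mult_difference\<close> expects.\<close>
  have "D * V = fps_const (v 0) + fps_const (v 1 - 3 * v 0) * fps_X
      + fps_X * (fps_X * Abs_fps (\<lambda>n. f (n + 1) - f n))"
    unfolding D_def V_def fps_recurrence[OF rec_v] by (simp add: power2_eq_square mult.assoc)
  then have V: "D * V = 1 - fps_X + fps_X * ((1 - fps_X) * F - 1)"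
    unfolding fps_X_mult_difference F_def[symmetric] const by simp
  have c: "Abs_fps c = 2 * ((1 - fps_X) * V - 1) - fps_X * F"
  proof -
    have "Abs_fps c = 2 * (fps_X * Abs_fps (\<lambda>n. v (n + 1) - v n)) - fps_X * F"
      by (rule fps_ext) (simp add: c_def F_def numeral_fps_const split: nat.split)
    then show ?thesis
      unfolding fps_X_mult_difference V_def[symmetric] const .
  qed
  have "D * S = fps_const (s 0) + fps_const (s 1 - 3 * s 0) * fps_X + fps_X ^ 2 * Abs_fps c"
    unfolding D_def S_def by (rule fps_recurrence[OF rec_s])
  then have S: "D * S = 1 - 2 * fps_X + fps_X ^ 2 * (2 * ((1 - fps_X) * V - 1) - fps_X * F)"
    unfolding c const by simp
  \<comment> \<open>A second factor \<open>D\<close> clears \<open>F\<close>, since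
    \<open>D * F\<close> is a polynomial.\<close>
  have DDV: "D * (D * V) = D - 2 * fps_X * D + fps_X * (1 - fps_X) * (1 - 2 * fps_X)"
    unfolding V F[symmetric] by (simp add: algebra_simps)
  \<comment> \<open>\<open>D\<close>, \<open>D ^ 2\<close> and \<open>D ^ 3\<close> clear the
    denominators of \<open>F\<close>, \<open>V\<close> and \<open>S\<close> respectively, so this
    multiple of \<open>S\<close> is a polynomial.\<close>
  have "D ^ 3 * S = D * (D * (D * S))"
    by (simp add: power3_eq_cube mult.assoc)
  also have "\<dots> = D * (D * (1 - 2 * fps_X - 2 * fps_X ^ 2)) + 2 * fps_X ^ 2 * (1 - fps_X) * (D * (D * V))
      - fps_X ^ 3 * (D * (D * F))"
    unfolding S by (simp add: algebra_simps power2_eq_square power3_eq_cube)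
  also have "\<dots> = 1 - 8 * fps_X + 23 * fps_X ^ 2 - 27 * fps_X ^ 3 + 12 * fps_X ^ 4 - 5 * fps_X ^ 5"
    unfolding DDV F unfolding D_def by algebra
  finally have "D ^ 3 * S = \<dots>" .
  \<comment> \<open>The constant coefficient of \<open>D\<close> is 1, so \<open>D ^ 3\<close> can
    be cancelled.\<close>
  moreover have "D \<noteq> 0"
  proof
    assume "D = 0"
    then have "fps_nth D 0 = 0" by simp
    then show False by (simp add: D_def numeral_fps_const)
  qed
  ultimately have "S = (1 - 8 * fps_X + 23 * fps_X ^ 2 - 27 * fps_X ^ 3 + 12 * fps_X ^ 4 - 5 * fps_X ^ 5) / D ^ 3"
    by (metis nonzero_mult_div_cancel_left power_not_zero)
  moreover have "avoiders n T = {p. p \<in> permutations_of_set {1..n} \<and> triple_free p}" for n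
    unfolding avoiders_def assms
    by (intro Collect_cong conj_cong refl triple_free_iff_avoids) (rule permutations_of_setD(2))
  then have "avoiders_gf T = S"
    by (intro fps_ext) (simp add: avoiders_gf_def S_def s_def num_triple_free_def)
  ultimately show ?thesis by (simp add: D_def)
qed

end
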